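(* Let $\lambda>0$, let $W\sim\mathrm{Skellam}(\lambda,\lambda)$, let $\nu\in\mathbb{N}=\{0,1,2,\dots\}$, and put $\alpha_0=-\log(\sqrt2-1)$ and $H(\nu,2\lambda)=\sum_{k=1}^{\infty}\frac{I_{\nu+k}(2\lambda)}{I_\nu(2\lambda)}$. Let $\mathcal{L}(0,2\lambda)$ and $\mathcal{U}(0,2\lambda)$ be the explicit quantities defined in the context (with $x=2\lambda$). (1) If $\nu\leq 2\lambda$, then $$\frac{2\exp\left(-\frac{\nu(\nu+1)}{4\lambda}\right)}{1+2\,\mathcal{U}(0,2\lambda)}\leq\frac{\mathbb{P}[|W|>\nu]}{H(\nu,2\lambda)}\leq\frac{2\exp\left(-\frac{\alpha_0}{4\lambda}\nu^2\right)}{1+2\,\mathcal{L}(0,2\lambda)}.$$ (2) If $\nu>2\lambda$, then $$\frac{2\exp\left(-\frac{[2\lambda]([2\lambda]+1)}{4\lambda}\right)B\left([2\lambda]+\lambda+1,\nu-[2\lambda]\right)\frac{\lambda^{\nu-[2\lambda]}}{(\nu-[2\lambda]-1)!}}{1+2\,\mathcal{U}(0,2\lambda)}\leq\frac{\mathbb{P}[|W|>\nu]}{H(\nu,2\lambda)}$$ and $$\frac{\mathbb{P}[|W|>\nu]}{H(\nu,2\lambda)}\leq\frac{2\exp\left(-\frac{\alpha_0}{4\lambda}[2\lambda]^2\right)B\left([2\lambda]+2\lambda+\frac12,\nu-[2\lambda]\right)\frac{(2\lambda)^{\nu-[2\lambda]}}{(\nu-[2\lambda]-1)!}}{1+2\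,\mathcal{L}(0,2\lambda)}.$$
   Context: $W\sim\mathrm{Skellam}(\lambda,\lambda)$ means that $W$ is distributed as $X_1-X_2$ with $X_1,X_2\sim\mathrm{Pois}(\lambda)$ independent; equivalently $\mathbb{P}[W=n]=e^{-2\lambda}I_{|n|}(2\lambda)$ for $n\in\mathbb{Z}$, where $I_{\nu}(x)=\sum_{k=0}^{\infty}\frac{1}{k!\,\Gamma(k+\nu+1)}\left(\frac{x}{2}\right)^{2k+\nu}$ is the modified Bessel function of the first kind. $B(\cdot,\cdot)$ is the Beta function; $[x]$ is the floor of $x$; $\log$ is the natural logarithm. Put $F(\nu,x)=\frac{x}{\nu+\sqrt{\nu^2+x^2}}$. If $[x]\geq 2$: $$\mathcal{L}(0,x)=\frac{2x\,e^{-\frac1x}}{\frac32+\sqrt{\frac94+4x}}-\frac{2x\,e^{-\frac{1}{2x}([x]+1)([x]+2)}}{[x]+\frac32+\sqrt{\left([x]+\frac32\right)^2+\frac{8x}{\pi}}}+e^{-\frac{([x]-1)[x]}{2x}}F([x],x)\bigl(1+F([x]+1,x)\bigr),$$ $$\mathcal{U}(0,x)=\frac{2x}{\alpha_0}\left[\frac{1}{\sqrt{\frac{8x}{\pi\alpha_0}}}-\frac{e^{-\frac{\alpha_0x}{2}}}{x+\sqrt{x^2+\frac{4x}{\alpha_0}}}\right]+e^{-\frac{\alpha_0}{2x}([x]-1)^2}\,\frac{F\left([x]-\frac12,x\right)}{1-F\left([x]+\frac12,x\right)}.$$ If $[x]<2$: $$\mathcal{L}(0,x)=F(1,x)\bigl(1+F(2,x)\bigr),\qquad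 \mathcal{U}(0,x)=\frac{F\left(\frac12,x\right)}{1-F\left(\frac32,x\right)}.$$ *)

theory Defs
  imports "HOL-Probability.Probability"
begin

(* Meaningful for positive rates only, as is poisson_pmf. *)
definition skellam_pmf :: "real \<Rightarrow> real \<Rightarrow> int pmf" where
  "skellam_pmf \<mu>\<^sub>1 \<mu>\<^sub>2 =
     map_pmf (\<lambda>(m, n). int m - int n) (pair_pmf (poisson_pmf \<mu>\<^sub>1) (poisson_pmf \<mu>\<^sub>2))"

(* Modified Bessel function of the first kind; meant for x > 0 only, because of powr
   (in particular 0 powr 0 = 0). *)
definition bessel_I :: "real \<Rightarrow> real \<Rightarrow> real" where
  "bessel_I \<nu> x =
     (\<Sum>k. 1 / (fact k * Gamma (real k + \<nu> + 1)) * (x / 2) powr (2 * real k + \<nu>))"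

(* The sum over k \<ge> 1 is indexed from 0, hence Suc k. *)
definition bessel_H :: "real \<Rightarrow> real \<Rightarrow> real" where
  "bessel_H \<nu> x = (\<Sum>k. bessel_I (\<nu> + real (Suc k)) x / bessel_I \<nu> x)"

definition alpha0 :: real where
  "alpha0 = - ln (sqrt 2 - 1)"

definition bessel_F :: "real \<Rightarrow> real \<Rightarrow> real" where
  "bessel_F \<nu> x = x / (\<nu> + sqrt (\<nu>\<^sup>2 + x\<^sup>2))"

(* Explicit lower and upper bounds for bessel_H 0 x. *)
definition H0_lower :: "real \<Rightarrow> real" where
  "H0_lower x =
    (let m = real_of_int \<lfloor>x\<rfloor> in
     if \<lfloor>x\<rfloor> \<ge> 2 then
         2 * x * exp (- (1 / x)) / (3/2 + sqrt (9/4 + 4 * x))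
       - 2 * x * exp (- (1 / (2 * x)) * (m + 1) * (m + 2))
           / (m + 3/2 + sqrt ((m + 3/2)\<^sup>2 + 8 * x / pi))
       + exp (- ((m - 1) * m / (2 * x))) * bessel_F m x * (1 + bessel_F (m + 1) x)
     else bessel_F 1 x * (1 + bessel_F 2 x))"

definition H0_upper :: "real \<Rightarrow> real" where
  "H0_upper x =
    (let m = real_of_int \<lfloor>x\<rfloor> in
     if \<lfloor>x\<rfloor> \<ge> 2 then
         2 * x / alpha0 *
           (1 / sqrt (8 * x / (pi * alpha0))
            - exp (- (alpha0 * x / 2)) / (x + sqrt (x\<^sup>2 + 4 * x / alpha0)))
       + exp (- (alpha0 / (2 * x)) * (m - 1)\<^sup>2)
           * (bessel_F (m - 1/2) x / (1 - bessel_F (m + 1/2) x))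
     else bessel_F (1/2) x / (1 - bessel_F (3/2) x))"

end

theory Submission
  imports Defs
begin

text \<open>
  Write \<open>x = 2 \<lambda>\<close>. Since \<open>P[W = n] = exp (- x) I\<^bsub>|n|\<^esub>(x)\<close> sums to one, \<open>exp (- x) I\<^sub>0(x) = 1 / (1 + 2 H(0, x))\<close>, so
  the quotient in question equals \<open>2 (I\<^sub>\<nu>(x) / I\<^sub>0(x)) / (1 + 2 H(0, x))\<close>. Everything follows from
  Amos' bounds \<open>F(n, x) \<le> I\<^sub>n(x) / I\<^bsub>n-1\<^esub>(x) \<le> F(n - 1/2, x)\<close>, which the three-term recurrence reduces to
  the two Turan-type inequalities \<open>0 \<le> x (I\<^sub>n\<^sup>2 - I\<^bsub>n-1\<^esub> I\<^bsub>n+1\<^esub>) \<le> I\<^sub>n I\<^bsub>n-1\<^esub>\<close>; these hold coefficientwise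
  by Vandermonde's identity. Because \<open>F(\<nu>, x) = exp (- arsinh (\<nu> / x))\<close> and \<open>\<alpha>\<^sub>0 = arsinh 1\<close>, the
  products of these bounds are Gaussian in the index up to \<open>x\<close>; beyond \<open>x\<close> rational bounds on \<open>F\<close>
  give the Beta factors. \<open>H(0, x)\<close> is then estimated by Gaussian sums and Mills-type tail bounds.
\<close>

section \<open>Modified Bessel functions of integer order\<close>

lemma bessel_I_nat_summable:
  fixes x :: real
  shows "summable (\<lambda>k. (x/2) ^ (2 * k + n) / (fact k * fact (k + n)))"
proof (rule summable_comparison_test')
  show "summable (\<lambda>k. \<bar>x/2\<bar> ^ n * (((x/2)\<^sup>2) ^ k / fact k))"
    using summable_exp[of "(x/2)\<^sup>2"] by (intro summable_mult) (simp add: field_simps)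
next
  fix k :: nat
  have "(1::real) \<le> fact (k + n)" by (rule fact_ge_1)
  then have "(fact k :: real) * 1 \<le> fact k * fact (k + n)"
    by (intro mult_left_mono) auto
  then have "\<bar>x/2\<bar> ^ (2 * k + n) / (fact k * fact (k + n)) \<le> \<bar>x/2\<bar> ^ (2 * k + n) / fact k"
    by (intro divide_left_mono mult_pos_pos) auto
  also have "\<dots> = \<bar>x/2\<bar> ^ n * (((x/2)\<^sup>2) ^ k / fact k)"
    by (simp only: power_add power_mult power2_abs) simp
  finally show "norm ((x/2) ^ (2 * k + n) / (fact k * fact (k + n)))
      \<le> \<bar>x/2\<bar> ^ n * (((x/2)\<^sup>2) ^ k / fact k)"
    by (simp add: power_abs abs_mult)
qed

text \<open>For positive x and integer order, \<open>Gamma\<close> and \<open>powr\<close> become a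
  factorial and an ordinary power; the coefficient comparisons below use this form.\<close>

lemma bessel_I_nat_sums:
  fixes x :: real
  assumes "0 < x"
  shows "(\<lambda>k. (x/2) ^ (2 * k + n) / (fact k * fact (k + n))) sums bessel_I (real n) x"
proof -
  have "1 / (fact k * Gamma (real k + real n + 1)) * (x / 2) powr (2 * real k + real n)
      = (x/2) ^ (2 * k + n) / (fact k * fact (k + n))" for k
    using assms Gamma_fact[of "k + n", where 'a = real] powr_realpow[of "x/2" "2 * k + n"]
    by (simp add: add_ac)
  then show ?thesis
    unfolding bessel_I_def using summable_sums[OF bessel_I_nat_summable] by simp
qed

lemma bessel_I_pos:
  fixes x :: real
  assumes "0 < x"
  shows "0 < bessel_I (real n) x"
proof -
  have "0 < (\<Sum>k. (x/2) ^ (2 * k + n) / (fact k * fact (k + n)))"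
    using assms by (intro suminf_pos bessel_I_nat_summable) auto
  then show ?thesis using bessel_I_nat_sums[OF assms] by (simp add: sums_iff)
qed

text \<open>Coefficientwise, 1/(k! (k+n)!) - 1/((k-1)! (k+n+1)!) = (n+1)/(k! (k+n+1)!), once the
  series of order n + 2 is shifted by one place to match powers of x.\<close>

lemma bessel_I_recurrence:
  fixes x :: real
  assumes "0 < x"
  shows "bessel_I (real n) x - bessel_I (real (n + 2)) x
    = 2 * real (n + 1) / x * bessel_I (real (n + 1)) x"
proof -
  let ?t = "\<lambda>n k. (x/2) ^ (2 * k + n) / (fact k * fact (k + n))"
  have "(\<lambda>k. ?t (n + 2) k) sums bessel_I (real (n + 2)) x"
    by (rule bessel_I_nat_sums[OF assms])
  then have "(\<lambda>k. if k = 0 then 0 else ?t (n + 2) (k - 1)) sums bessel_I (real (n + 2)) x"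
    using sums_Suc[where f = "\<lambda>k. if k = 0 then 0 else ?t (n + 2) (k - 1)"] by simp
  from sums_diff[OF bessel_I_nat_sums[OF assms, of n] this]
  have "(\<lambda>k. ?t n k - (if k = 0 then 0 else ?t (n + 2) (k - 1)))
      sums (bessel_I (real n) x - bessel_I (real (n + 2)) x)" .
  moreover have "?t n k - (if k = 0 then 0 else ?t (n + 2) (k - 1))
      = 2 * real (n + 1) / x * ?t (n + 1) k" for k
  proof (cases k)
    case 0
    have "fact (n + 1) = real (n + 1) * fact n" by simp
    moreover have "a / B = 2 * w / x * (a * (x/2) / (w * B))" if "0 < w" for a B w :: real
      using that assms by (simp add: field_simps)
    from this[of "real (n + 1)" "(x/2) ^ n" "fact n"] have "(x/2) ^ n / fact n = 2 * real (n + 1) / x * ((x/2) ^ n * (x/2) / (real (n + 1) * fact n))"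
      by simp
    ultimately show ?thesis unfolding 0 by (simp add: mult.commute)
  next
    case (Suc j)
    have "2 * Suc j + n = 2 * j + (n + 2)" "k = Suc j" using Suc by auto
    have f: "fact (Suc j + n) = real (Suc j + n) * fact (j + n)"
            "fact (Suc j + (n + 1)) = real (Suc j + n + 1) * (real (Suc j + n) * fact (j + n))"
            "fact (j + (n + 2)) = real (Suc j + n + 1) * (real (Suc j + n) * fact (j + n))"
      "fact (Suc j) = real (Suc j) * fact j"
      by (simp_all add: algebra_simps)
    have p: "(x/2) ^ (2 * Suc j + n) = (x/2) ^ (2 * j + n) * (x/2)^2"
      "(x/2) ^ (2 * j + (n + 2)) = (x/2) ^ (2 * j + n) * (x/2)^2"
      "(x/2) ^ (2 * Suc j + (n + 1)) = (x/2) ^ (2 * j + n) * (x/2)^2 * (x/2)"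
      by (simp_all add: power_add power2_eq_square)
    \<comment> \<open>\<open>A\<close> and \<open>B\<close> stand for j! and (j+n)!, and
      \<open>r\<close>, \<open>s\<close>, \<open>q\<close> for the factors j+1, j+n+1, j+n+2 split
      off above, so that q - r = n + 1.\<close>
    have eq: "a / (r * A * (s * B)) - a / (A * (q * (s * B)))
        = 2 * w / x * (a * (x/2) / (r * A * (q * (s * B))))"
      if "0 < r" "0 < s" "0 < q" "0 < A" "0 < B" "w = q - r" for a r A s B q w :: real
    proof -
      have "a / (r * A * (s * B)) - a / (A * (q * (s * B))) = a * (q - r) / (r * A * (q * (s * B)))"
        using that(1-5) by (simp add: field_simps)
      also have "\<dots> = a * w / (r * A * (q * (s * B)))" unfolding that(6) ..
      also have "\<dots> = 2 * w / x * (a * (x/2) / (r * A * (q * (s * B))))" using assms by simp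
      finally show ?thesis .
    qed
    show ?thesis
      unfolding Suc by (simp only: f p if_False nat.distinct diff_Suc_1) (rule eq; simp)
  qed
  ultimately have "(\<lambda>k. 2 * real (n + 1) / x * ?t (n + 1) k)
      sums (bessel_I (real n) x - bessel_I (real (n + 2)) x)" by simp
  from sums_unique2[OF this sums_mult[OF bessel_I_nat_sums[OF assms]]] show ?thesis .
qed

section \<open>Products of Bessel series and Turan-type inequalities\<close>

lemma sum_inverse_fact_convolution:
  "(\<Sum>i\<le>k. 1 / (fact i * fact (i + m)) * (1 / (fact (k - i) * fact (k - i + n))))
    = (fact (m + n + 2 * k) / (fact k * fact (m + k) * fact (n + k) * fact (m + n + k)) :: real)"
proof -
  \<comment> \<open>Multiplying by (m+k)! (n+k)! turns each summand into a product of two binomial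
    coefficients, to which Vandermonde's identity applies.\<close>
  have "(\<Sum>i\<le>k. 1 / (fact i * fact (i + m)) * (1 / (fact (k - i) * fact (k - i + n))))
      = (\<Sum>i\<le>k. real ((n + k) choose i) * real ((m + k) choose (k - i)) / (fact (m + k) * fact (n + k)))"
  proof (rule sum.cong[OF refl])
    fix i assume "i \<in> {..k}"
    then have "i \<le> k" by simp
    then have c: "real ((n + k) choose i) = fact (n + k) / (fact i * fact (k - i + n))"
      "real ((m + k) choose (k - i)) = fact (m + k) / (fact (k - i) * fact (i + m))"
      by (simp_all add: binomial_fact add.commute)
    show "1 / (fact i * fact (i + m)) * (1 / (fact (k - i) * fact (k - i + n)))
      = real ((n + k) choose i) * real ((m + k) choose (k - i)) / (fact (m + k) * fact (n + k))"
      unfolding c by (simp add: field_simps)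
  qed
  also have "\<dots> = real ((n + k + (m + k)) choose k) / (fact (m + k) * fact (n + k))"
    unfolding sum_divide_distrib[symmetric] vandermonde[symmetric] by simp
  also have "real ((n + k + (m + k)) choose k) = fact (m + n + 2 * k) / (fact k * fact (m + n + k))"
  proof -
    have "n + k + (m + k) = m + n + 2 * k" "m + n + 2 * k - k = m + n + k" by simp_all
    then show ?thesis using binomial_fact[of k "m + n + 2 * k", where 'a = real]
      by (simp only: le_add2)
  qed
  finally show ?thesis by (simp add: field_simps)
qed

lemma bessel_I_mult_sums:
  fixes x :: real
  assumes "0 < x"
  shows "(\<lambda>k. (x/2) ^ (m + n + 2 * k) * (fact (m + n + 2 * k)
      / (fact k * fact (m + k) * fact (n + k) * fact (m + n + k))))
    sums (bessel_I (real m) x * bessel_I (real n) x)"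
proof -
  let ?t = "\<lambda>n k. (x/2) ^ (2 * k + n) / (fact k * fact (k + n))"
  \<comment> \<open>Since x > 0 the terms are their own norms, so convergence is absolute, as the
    Cauchy product requires.\<close>
  have nonneg: "norm (?t n k) = ?t n k" for n k using assms by simp
  have "(\<lambda>k. \<Sum>i\<le>k. ?t m i * ?t n (k - i)) sums (suminf (?t m) * suminf (?t n))"
    by (rule Cauchy_product_sums) (use bessel_I_nat_summable in \<open>simp_all only: nonneg\<close>)
  moreover have "(\<Sum>i\<le>k. ?t m i * ?t n (k - i)) = (x/2) ^ (m + n + 2 * k) * (fact (m + n + 2 * k)
      / (fact k * fact (m + k) * fact (n + k) * fact (m + n + k)))" for k
  proof -
    have "?t m i * ?t n (k - i) = (x/2) ^ (m + n + 2 * k) *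
        (1 / (fact i * fact (i + m)) * (1 / (fact (k - i) * fact (k - i + n))))" if "i \<le> k" for i
    proof -
      have "m + n + 2 * k = (2 * i + m) + (2 * (k - i) + n)" using that by simp
      then show ?thesis by (simp only: power_add) simp
    qed
    then show ?thesis
      unfolding sum_inverse_fact_convolution[symmetric] sum_distrib_left by (intro sum.cong) auto
  qed
  ultimately show ?thesis
    using bessel_I_nat_sums[OF assms] by (simp add: sums_iff)
qed

text \<open>Both products have the same powers of x. With E = (n+1+k)! their coefficients differ in
  1/E^2 against 1/((n+k)! (n+2+k)!), and the difference of these two is 1/(E (n+2+k)!), which is
  positive.\<close>

lemma bessel_I_turan_sums:
  fixes x :: real
  assumes "0 < x"
  shows "(\<lambda>k. (x/2) ^ (2 * n + 2 + 2 * k) * (fact (2 * n + 2 + 2 * k)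
      / (fact k * fact (2 * n + 2 + k) * fact (n + 1 + k) * fact (n + 2 + k))))
    sums ((bessel_I (real (n + 1)) x)\<^sup>2 - bessel_I (real n) x * bessel_I (real (n + 2)) x)"
proof -
  have "a * (b / (d * E * E * g)) - a * (b / (d * A * C * g)) = a * (b / (d * g * E * C))"
    if "E = w * A" "C = v * E" "v - w = 1" "0 < w" "0 < v" "0 < A" "0 < d" "0 < g"
    for a b d E A g C v w :: real
  proof -
    have "a * (b / (d * E * E * g)) - a * (b / (d * A * C * g)) = a * (b * (v - w) / (d * g * E * C))"
      unfolding that(1,2) using that(4-) by (simp add: field_simps)
    then show ?thesis using that(3) by simp
  qed
  note key = this[where w = "real (n + 1 + k)" and v = "real (n + 2 + k)" and A = "fact (n + k)" for k]
  have "(\<lambda>k. (x/2) ^ (n + 1 + (n + 1) + 2 * k) * (fact (n + 1 + (n + 1) + 2 * k)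
      / (fact k * fact (n + 1 + k) * fact (n + 1 + k) * fact (n + 1 + (n + 1) + k)))
    - (x/2) ^ (n + (n + 2) + 2 * k) * (fact (n + (n + 2) + 2 * k)
      / (fact k * fact (n + k) * fact (n + 2 + k) * fact (n + (n + 2) + k))))
    sums (bessel_I (real (n + 1)) x * bessel_I (real (n + 1)) x
      - bessel_I (real n) x * bessel_I (real (n + 2)) x)" (is "?f sums _")
    by (intro sums_diff bessel_I_mult_sums assms)
  moreover have "?f k = (x/2) ^ (2 * n + 2 + 2 * k) * (fact (2 * n + 2 + 2 * k)
      / (fact k * fact (2 * n + 2 + k) * fact (n + 1 + k) * fact (n + 2 + k)))" for k
  proof -
    have e: "n + 1 + (n + 1) + j = 2 * n + 2 + j" "n + (n + 2) + j = 2 * n + 2 + j" for j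
      by simp_all
    show ?thesis unfolding e by (rule key) (rule fact_gt_zero | simp add: algebra_simps)+
  qed
  ultimately show ?thesis by (simp only: power2_eq_square)
qed

lemma bessel_I_turan:
  fixes x :: real
  assumes "0 < x"
  shows "bessel_I (real n) x * bessel_I (real (n + 2)) x \<le> (bessel_I (real (n + 1)) x)\<^sup>2"
  using sums_le[OF _ sums_zero bessel_I_turan_sums[OF assms, of n]] assms by simp

text \<open>The factor x shifts the powers, so term k on the left meets term k + 1 of the product
  series on the right. The right one is larger by the factor (2n+2k+3)/(2k+2) >= 1, and the
  unmatched term 0 is nonnegative.\<close>

lemma bessel_I_turan_reverse:
  fixes x :: real
  assumes "0 < x"
  shows "x * ((bessel_I (real (n + 1)) x)\<^sup>2 - bessel_I (real n) x * bessel_I (real (n + 2)) x)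
    \<le> bessel_I (real n) x * bessel_I (real (n + 1)) x"
proof -
  let ?g = "\<lambda>k. (x/2) ^ (n + (n + 1) + 2 * k) * (fact (n + (n + 1) + 2 * k)
      / (fact k * fact (n + k) * fact (n + 1 + k) * fact (n + (n + 1) + k)))"
  let ?f = "\<lambda>k. x * ((x/2) ^ (2 * n + 2 + 2 * k) * (fact (2 * n + 2 + 2 * k)
      / (fact k * fact (2 * n + 2 + k) * fact (n + 1 + k) * fact (n + 2 + k))))"
  have g: "?g sums (bessel_I (real n) x * bessel_I (real (n + 1)) x)"
    by (rule bessel_I_mult_sums[OF assms])
  then have g': "(\<lambda>k. ?g (Suc k)) sums (bessel_I (real n) x * bessel_I (real (n + 1)) x - ?g 0)"
    by (subst sums_Suc_iff) simp
  have le: "?f k \<le> ?g (Suc k)" for k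
  proof -
    have p: "x * (x/2) ^ (2 * n + 2 + 2 * k) = 2 * (x/2) ^ (n + (n + 1) + 2 * Suc k)"
      by (simp add: power_add)
    have e: "n + (n + 1) + 2 * Suc k = Suc (2 * n + 2 + 2 * k)" "n + Suc k = n + 1 + k"
      "n + 1 + Suc k = n + 2 + k" "n + (n + 1) + Suc k = 2 * n + 2 + k" by simp_all
    have "2 * A * (b / (d * E * F * G)) \<le> A * (v * b / (u * d * F * G * E))"
      if "2 * u \<le> v" "0 < u" "0 \<le> A" "0 < b" "0 < d" "0 < E" "0 < F" "0 < G"
      for A b d E F G u v :: real
    proof -
      have "2 * A * (b / (d * E * F * G)) = 2 * (A * (b / (d * E * F * G)))" by simp
      also have "\<dots> \<le> (v / u) * (A * (b / (d * E * F * G)))"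
        using that by (intro mult_right_mono mult_nonneg_nonneg divide_nonneg_pos mult_pos_pos)
          (auto simp: field_simps)
      also have "\<dots> = A * (v * b / (u * d * F * G * E))" using that by (simp add: field_simps)
      finally show ?thesis .
    qed
    from this[where u = "real (Suc k)" and v = "real (Suc (2 * n + 2 + 2 * k))"
        and A = "(x/2) ^ (n + (n + 1) + 2 * Suc k)" and b = "fact (2 * n + 2 + 2 * k)"
        and d = "fact k" and E = "fact (2 * n + 2 + k)" and F = "fact (n + 1 + k)"
        and G = "fact (n + 2 + k)"]
    show ?thesis
      unfolding mult.assoc[symmetric] p unfolding e fact_Suc using assms by (simp add: mult.assoc)
  qed
  have "x * ((bessel_I (real (n + 1)) x)\<^sup>2 - bessel_I (real n) x * bessel_I (real (n + 2)) x)
      \<le> bessel_I (real n) x * bessel_I (real (n + 1)) x - ?g 0"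
    by (rule sums_le[OF le sums_mult[OF bessel_I_turan_sums[OF assms]] g'])
  moreover have "0 \<le> ?g 0" using assms by simp
  ultimately show ?thesis by linarith
qed

section \<open>The function F and Amos' bounds on consecutive ratios\<close>

lemma bessel_F_pos: "0 < x \<Longrightarrow> 0 < bessel_F \<nu> x"
proof -
  assume "0 < x"
  then have "\<bar>\<nu>\<bar> < sqrt (\<nu>\<^sup>2 + x\<^sup>2)" by (intro real_less_rsqrt) auto
  with \<open>0 < x\<close> show ?thesis unfolding bessel_F_def by simp
qed

text \<open>Rationalising the denominator gives x F = sqrt (\<nu>^2 + x^2) - \<nu>, so F is the
  positive root of x r^2 + 2 \<nu> r - x.\<close>

lemma bessel_F_quadratic:
  assumes "0 < x"
  shows "x * (bessel_F \<nu> x)\<^sup>2 + 2 * \<nu> * bessel_F \<nu> x = x"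
proof -
  define s where "s = sqrt (\<nu>\<^sup>2 + x\<^sup>2)"
  have s: "s\<^sup>2 = \<nu>\<^sup>2 + x\<^sup>2" unfolding s_def by simp
  have "\<bar>\<nu>\<bar> < s" unfolding s_def using assms by (intro real_less_rsqrt) auto
  then have p: "0 < \<nu> + s" by linarith
  have "(s - \<nu>) * (s + \<nu>) = x\<^sup>2" using s by (simp add: algebra_simps power2_eq_square)
  then have F: "x * bessel_F \<nu> x = s - \<nu>"
    using p unfolding bessel_F_def s_def[symmetric] by (simp add: field_simps power2_eq_square)
  have "x * (x * (bessel_F \<nu> x)\<^sup>2 + 2 * \<nu> * bessel_F \<nu> x)
      = (x * bessel_F \<nu> x)\<^sup>2 + 2 * \<nu> * (x * bessel_F \<nu> x)"
    by (simp add: power2_eq_square algebra_simps)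
  also have "\<dots> = x * x" unfolding F using s by (simp add: power2_eq_square algebra_simps)
  finally show ?thesis using assms by simp
qed

text \<open>The polynomial factors as (r - F) (x (r + F) + 2 \<nu>) with positive second factor, so
  bounding F amounts to a quadratic inequality.\<close>

lemma bessel_F_le_iff:
  assumes "0 < x" "0 \<le> \<nu>" "0 \<le> r"
  shows "bessel_F \<nu> x \<le> r \<longleftrightarrow> x \<le> x * r\<^sup>2 + 2 * \<nu> * r"
proof -
  define P where "P = x * (r + bessel_F \<nu> x) + 2 * \<nu>"
  have "x * r\<^sup>2 + 2 * \<nu> * r - x = (r - bessel_F \<nu> x) * P"
    unfolding P_def using bessel_F_quadratic[OF assms(1), of \<nu>]
    by (simp add: algebra_simps power2_eq_square)
  moreover have "0 < P"
    unfolding P_def using assms bessel_F_pos[OF assms(1), of \<nu>]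
    by (intro add_pos_nonneg mult_pos_pos add_nonneg_pos) auto
  ultimately have "0 \<le> x * r\<^sup>2 + 2 * \<nu> * r - x \<longleftrightarrow> 0 \<le> r - bessel_F \<nu> x"
    by (simp add: zero_le_mult_iff)
  then show ?thesis by simp
qed

text \<open>Eliminating the term of order n + 2 between the recurrence and the Turan inequality
  leaves x r^2 + 2 (n + 1) r >= x for the ratio r.\<close>

lemma bessel_I_ratio_lower:
  assumes "0 < x"
  shows "bessel_F (real n + 1) x \<le> bessel_I (real (n + 1)) x / bessel_I (real n) x"
proof (subst bessel_F_le_iff)
  define a b c where "a = bessel_I (real n) x" "b = bessel_I (real (n + 1)) x"
    "c = bessel_I (real (n + 2)) x"
  have pos: "0 < a" "0 < b" unfolding a_b_c_def using bessel_I_pos[OF assms, of n] bessel_I_pos[OF assms, of "n + 1"]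
    by simp_all
  have r: "a - c = 2 * real (n + 1) / x * b"
    unfolding a_b_c_def by (rule bessel_I_recurrence[OF assms])
  have "x * (a - c) = 2 * real (n + 1) * b" unfolding r using assms by simp
  moreover have "a * c \<le> b\<^sup>2" unfolding a_b_c_def by (rule bessel_I_turan[OF assms])
  then have "x * (a * c) \<le> x * b\<^sup>2" using assms by simp
  moreover have "x * a\<^sup>2 = a * (x * (a - c)) + x * (a * c)"
    by (simp add: algebra_simps power2_eq_square)
  ultimately have "x * a\<^sup>2 \<le> x * b\<^sup>2 + 2 * (real n + 1) * b * a"
    by (simp add: algebra_simps)
  then show "x \<le> x * (b / a)\<^sup>2 + 2 * (real n + 1) * (b / a)"
    using pos by (simp add: field_simps power2_eq_square)
qed (use assms bessel_I_pos[OF assms, of n] bessel_I_pos[OF assms, of "n + 1"] in simp_all)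

text \<open>The extra term a b of the reverse Turan inequality lowers 2 (n + 1) to 2 n + 1, so the
  ratio satisfies x r^2 + (2 n + 1) r <= x. Strict monotonicity of this quadratic excludes a ratio
  above its root, which is F at n + 1/2.\<close>

lemma bessel_I_ratio_upper:
  assumes "0 < x"
  shows "bessel_I (real (n + 1)) x / bessel_I (real n) x \<le> bessel_F (real n + 1/2) x"
proof (rule ccontr)
  define a b c where "a = bessel_I (real n) x" "b = bessel_I (real (n + 1)) x"
    "c = bessel_I (real (n + 2)) x"
  assume "\<not> ?thesis"
  then have less: "bessel_F (real n + 1/2) x < b / a" unfolding a_b_c_def by simp
  have pos: "0 < a" "0 < b" unfolding a_b_c_def using bessel_I_pos[OF assms, of n] bessel_I_pos[OF assms, of "n + 1"]
    by simp_all
  have r: "a - c = 2 * real (n + 1) / x * b"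
    unfolding a_b_c_def by (rule bessel_I_recurrence[OF assms])
  have "x * (a - c) = 2 * real (n + 1) * b" unfolding r using assms by simp
  moreover have "x * (b\<^sup>2 - a * c) \<le> a * b" unfolding a_b_c_def by (rule bessel_I_turan_reverse[OF assms])
  moreover have "x * a\<^sup>2 = a * (x * (a - c)) + x * (a * c)"
    by (simp add: algebra_simps power2_eq_square)
  ultimately have "x * b\<^sup>2 + (2 * real n + 1) * b * a \<le> x * a\<^sup>2"
    by (simp add: algebra_simps)
  then have le: "x * (b / a)\<^sup>2 + 2 * (real n + 1/2) * (b / a) \<le> x"
    using pos by (simp add: field_simps power2_eq_square)
  let ?F = "bessel_F (real n + 1/2) x"
  have "x * ?F\<^sup>2 + 2 * (real n + 1/2) * ?F < x * (b / a)\<^sup>2 + 2 * (real n + 1/2) * (b / a)"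
    using less bessel_F_pos[OF assms, of "real n + 1/2"] assms
    by (intro add_strict_mono mult_strict_left_mono power_strict_mono) auto
  then show False using le bessel_F_quadratic[OF assms, of "real n + 1/2"] by linarith
qed

section \<open>Exponential and rational bounds on F\<close>

lemma bessel_F_eq_exp_arsinh:
  assumes "0 < x"
  shows "bessel_F \<nu> x = exp (- arsinh (\<nu> / x))"
proof -
  have "sqrt (\<nu>\<^sup>2 + x\<^sup>2) = x * sqrt ((\<nu> / x)\<^sup>2 + 1)"
  proof -
    have "\<nu>\<^sup>2 + x\<^sup>2 = x\<^sup>2 * ((\<nu> / x)\<^sup>2 + 1)" using assms by (simp add: field_simps)
    then show ?thesis using assms by (simp add: real_sqrt_mult)
  qed
  then have "\<nu> + sqrt (\<nu>\<^sup>2 + x\<^sup>2) = x * (\<nu> / x + sqrt ((\<nu> / x)\<^sup>2 + 1))"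
    using assms by (simp add: algebra_simps)
  then have "bessel_F \<nu> x = inverse (\<nu> / x + sqrt ((\<nu> / x)\<^sup>2 + 1))"
    unfolding bessel_F_def using assms by (simp add: inverse_eq_divide)
  then show ?thesis
    using arsinh_real_aux[of "\<nu> / x"] by (simp add: arsinh_real_def exp_minus)
qed

lemma arsinh_real_le_self:
  fixes t :: real
  assumes "0 \<le> t"
  shows "arsinh t \<le> t"
proof -
  have "0 - arsinh 0 \<le> t - arsinh t"
  proof (rule DERIV_nonneg_imp_nondecreasing[OF assms])
    fix s :: real assume "0 \<le> s" "s \<le> t"
    have "1 \<le> sqrt (s\<^sup>2 + 1)" by simp
    then have "1 / sqrt (s\<^sup>2 + 1) \<le> 1" by (subst divide_le_eq_1_pos) linarith+
    then show "\<exists>y. ((\<lambda>t. t - arsinh t) has_real_derivative y) (at s) \<and> 0 \<le> y"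
      by (intro exI[of _ "1 - 1 / sqrt (s\<^sup>2 + 1)"]) (auto intro!: derivative_eq_intros)
  qed
  then show ?thesis by simp
qed

lemma arsinh_one: "arsinh 1 = alpha0"
proof -
  have "(sqrt 2 - 1) * (1 + sqrt 2) = (1 :: real)" by (simp add: algebra_simps)
  moreover have "1 < sqrt (2 :: real)" by simp
  ultimately have "1 + sqrt 2 = inverse (sqrt 2 - 1 :: real)"
    by (simp add: field_simps)
  then show ?thesis
    using \<open>1 < sqrt 2\<close> by (simp add: alpha0_def arsinh_real_def ln_inverse)
qed

lemma alpha0_pos: "0 < alpha0"
  unfolding arsinh_one[symmetric] by simp

text \<open>\<open>sinh\<close> is convex on the nonnegative axis, so it lies below its chord from 0
  to \<open>alpha0\<close>, where it equals 1; monotonicity of \<open>sinh\<close> transfers this to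
  \<open>arsinh\<close>.\<close>

lemma arsinh_ge_alpha0_mult:
  assumes "0 \<le> t" "t \<le> 1"
  shows "alpha0 * t \<le> arsinh t"
proof -
  have "convex_on {0..} (sinh :: real \<Rightarrow> real)"
    by (rule f''_ge0_imp_convex[where f' = cosh and f'' = sinh])
      (auto intro!: derivative_eq_intros)
  from convex_onD[OF this assms, of 0 alpha0]
  have "sinh (alpha0 * t) \<le> t * sinh alpha0" using alpha0_pos by (simp add: mult.commute)
  also have "\<dots> = sinh (arsinh t)" unfolding arsinh_one[symmetric] by simp
  finally show ?thesis by (simp only: sinh_real_le_iff)
qed

lemma bessel_F_ge_exp:
  assumes "0 < x" "0 \<le> \<nu>"
  shows "exp (- (\<nu> / x)) \<le> bessel_F \<nu> x"
  using assms by (simp add: bessel_F_eq_exp_arsinh arsinh_real_le_self)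

lemma bessel_F_le_exp:
  assumes "0 < x" "0 \<le> \<nu>" "\<nu> \<le> x"
  shows "bessel_F \<nu> x \<le> exp (- (alpha0 * (\<nu> / x)))"
  using assms by (simp add: bessel_F_eq_exp_arsinh arsinh_ge_alpha0_mult del: times_divide_eq_right)

lemma bessel_F_antimono:
  assumes "0 < x" "\<mu> \<le> \<nu>"
  shows "bessel_F \<nu> x \<le> bessel_F \<mu> x"
proof (cases "\<mu> = \<nu>")
  case False
  then have "arsinh (\<mu> / x) < arsinh (\<nu> / x)"
    using assms by (simp add: divide_strict_right_mono)
  then show ?thesis using assms(1)
    by (simp only: bessel_F_eq_exp_arsinh exp_le_cancel_iff neg_le_iff_le less_imp_le)
qed simp

lemma bessel_F_less_1:
  assumes "0 < x" "0 < \<nu>"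
  shows "bessel_F \<nu> x < 1"
  using assms by (simp add: bessel_F_eq_exp_arsinh)

text \<open>The estimate sqrt (\<nu>^2 + x^2) <= \<nu> + x keeps the denominator linear in the
  index, so products of these bounds have rising factorials as denominators.\<close>

lemma bessel_F_ge_rational:
  assumes "0 < x" "0 \<le> \<nu>"
  shows "x / (2 * \<nu> + x) \<le> bessel_F \<nu> x"
proof -
  have "sqrt (\<nu>\<^sup>2 + x\<^sup>2) \<le> \<nu> + x" using assms by (intro real_le_lsqrt) (auto simp: power2_sum)
  moreover have "0 \<le> sqrt (\<nu>\<^sup>2 + x\<^sup>2)" "0 < \<nu>\<^sup>2 + x\<^sup>2" using assms by (simp_all add: add_nonneg_pos)
  ultimately show ?thesis unfolding bessel_F_def using assms
    by (intro divide_left_mono mult_pos_pos add_nonneg_pos) auto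
qed

lemma bessel_F_le_rational:
  assumes "0 < x" "0 \<le> \<nu>"
  shows "bessel_F \<nu> x \<le> x / (\<nu> + x)"
proof -
  have "x \<le> sqrt (\<nu>\<^sup>2 + x\<^sup>2)" using assms by (intro real_le_rsqrt) auto
  then show ?thesis unfolding bessel_F_def using assms by (intro divide_left_mono mult_pos_pos add_nonneg_pos real_sqrt_gt_zero) auto
qed

section \<open>The quotients I_n / I_0 as products of ratios\<close>

definition bessel_Q :: "nat \<Rightarrow> real \<Rightarrow> real" where
  "bessel_Q n x = bessel_I (real n) x / bessel_I 0 x"

lemma bessel_Q_0: "0 < x \<Longrightarrow> bessel_Q 0 x = 1"
  using bessel_I_pos[of x 0] by (simp add: bessel_Q_def)

lemma bessel_Q_pos: "0 < x \<Longrightarrow> 0 < bessel_Q n x"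
  using bessel_I_pos[of x 0] bessel_I_pos[of x n] by (simp add: bessel_Q_def)

lemma bessel_Q_Suc:
  "0 < x \<Longrightarrow> bessel_Q (Suc n) x = bessel_I (real (n + 1)) x / bessel_I (real n) x * bessel_Q n x"
  using bessel_I_pos[of x n] by (simp add: bessel_Q_def)

lemma bessel_Q_Suc_ge:
  "0 < x \<Longrightarrow> bessel_F (real n + 1) x * bessel_Q n x \<le> bessel_Q (Suc n) x"
  unfolding bessel_Q_Suc by (intro mult_right_mono bessel_I_ratio_lower less_imp_le[OF bessel_Q_pos])

lemma bessel_Q_Suc_le:
  "0 < x \<Longrightarrow> bessel_Q (Suc n) x \<le> bessel_F (real n + 1/2) x * bessel_Q n x"
  unfolding bessel_Q_Suc by (intro mult_right_mono bessel_I_ratio_upper less_imp_le[OF bessel_Q_pos])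

text \<open>The exponents j / x for j = 1, ..., n add up to n (n + 1) / (2 x).\<close>

lemma bessel_Q_ge_exp:
  assumes "0 < x"
  shows "exp (- (real n * (real n + 1) / (2 * x))) \<le> bessel_Q n x"
proof (induction n)
  case 0
  then show ?case using assms by (simp add: bessel_Q_0)
next
  case (Suc n)
  have "exp (- (real (Suc n) * (real (Suc n) + 1) / (2 * x)))
      = exp (- ((real n + 1) / x)) * exp (- (real n * (real n + 1) / (2 * x)))"
    unfolding exp_add[symmetric] using assms by (simp add: field_simps)
  also have "\<dots> \<le> bessel_F (real n + 1) x * bessel_Q n x"
    using assms Suc.IH by (intro mult_mono bessel_F_ge_exp less_imp_le[OF bessel_F_pos]) auto
  also have "\<dots> \<le> bessel_Q (Suc n) x" using assms by (rule bessel_Q_Suc_ge)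
  finally show ?case .
qed

text \<open>The quotients (j + 1/2) / x for j < n add up to n^2 / (2 x). The condition n <= x keeps
  all of them in the range of the chord bound on \<open>arsinh\<close>.\<close>

lemma bessel_Q_le_exp:
  assumes "0 < x" "real n \<le> x"
  shows "bessel_Q n x \<le> exp (- (alpha0 / (2 * x)) * (real n)\<^sup>2)"
  using assms(2)
proof (induction n)
  case 0
  then show ?case using assms by (simp add: bessel_Q_0)
next
  case (Suc n)
  have "bessel_Q (Suc n) x \<le> bessel_F (real n + 1/2) x * bessel_Q n x"
    using assms(1) by (rule bessel_Q_Suc_le)
  also have "\<dots> \<le> exp (- (alpha0 * ((real n + 1/2) / x))) * exp (- (alpha0 / (2 * x)) * (real n)\<^sup>2)"
    using assms(1) Suc by (intro mult_mono bessel_F_le_exp less_imp_le[OF bessel_Q_pos]) auto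
  also have "\<dots> = exp (- (alpha0 / (2 * x)) * (real (Suc n))\<^sup>2)"
    unfolding exp_add[symmetric] using assms(1) by (simp add: field_simps power2_eq_square)
  finally show ?case .
qed

lemma bessel_Q_ge_pochhammer:
  assumes "0 < x"
  shows "bessel_Q m x * (x/2) ^ d / pochhammer (real m + x/2 + 1) d \<le> bessel_Q (m + d) x"
proof (induction d)
  case (Suc d)
  let ?p = "pochhammer (real m + x/2 + 1) d"
  have "0 < ?p" using assms by (intro pochhammer_pos) auto
  have "bessel_Q m x * (x/2) ^ Suc d / pochhammer (real m + x/2 + 1) (Suc d)
      = x / (2 * (real (m + d) + 1) + x) * (bessel_Q m x * (x/2) ^ d / ?p)"
  proof -
    \<comment> \<open>Halving numerator and denominator of the rational bound exhibits the next
      factor of the rising factorial based at m + x/2 + 1.\<close>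
    have "real m + x/2 + 1 + real d = (2 * (real (m + d) + 1) + x) / 2" by (simp add: field_simps)
    then show ?thesis unfolding pochhammer_Suc by (simp add: mult_ac)
  qed
  also have "\<dots> \<le> bessel_F (real (m + d) + 1) x * bessel_Q (m + d) x"
    using assms Suc.IH \<open>0 < ?p\<close> bessel_Q_pos[OF assms, of m]
    by (intro mult_mono bessel_F_ge_rational less_imp_le[OF bessel_F_pos]) auto
  also have "\<dots> \<le> bessel_Q (Suc (m + d)) x" using assms by (rule bessel_Q_Suc_ge)
  finally show ?case by simp
qed simp

lemma bessel_Q_le_pochhammer:
  assumes "0 < x"
  shows "bessel_Q (m + d) x \<le> bessel_Q m x * x ^ d / pochhammer (real m + x + 1/2) d"
proof (induction d)
  case (Suc d)
  let ?p = "pochhammer (real m + x + 1/2) d"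
  have "bessel_Q (Suc (m + d)) x \<le> bessel_F (real (m + d) + 1/2) x * bessel_Q (m + d) x"
    using assms by (rule bessel_Q_Suc_le)
  also have "\<dots> \<le> x / (real (m + d) + 1/2 + x) * (bessel_Q m x * x ^ d / ?p)"
    using assms Suc.IH by (intro mult_mono bessel_F_le_rational less_imp_le[OF bessel_Q_pos]) auto
  also have "\<dots> = bessel_Q m x * x ^ Suc d / pochhammer (real m + x + 1/2) (Suc d)"
  proof -
    have "real m + x + 1/2 + real d = real (m + d) + 1/2 + x" by simp
    then show ?thesis unfolding pochhammer_Suc by (simp add: mult_ac)
  qed
  finally show ?case by simp
qed simp

text \<open>The value of \<open>Gamma\<close> at a cancels, leaving Gamma (d) over a rising
  factorial. Positivity of \<open>d\<close> makes \<open>d - 1\<close> a true predecessor.\<close>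

lemma Beta_nat_right:
  fixes a :: real
  assumes "0 < a" "0 < d"
  shows "Beta a (real d) = fact (d - 1) / pochhammer a d"
proof -
  have "a \<notin> \<int>\<^sub>\<le>\<^sub>0" using assms by auto
  then have "pochhammer a d = Gamma (a + real d) / Gamma a" by (rule pochhammer_Gamma)
  moreover have "Gamma (real d) = fact (d - 1)"
    using Gamma_fact[of "d - 1", where 'a = real] assms by simp
  ultimately show ?thesis by (simp add: Beta_def)
qed

section \<open>Geometric tails and the splitting of H(0, x)\<close>

lemma bessel_Q_geometric:
  assumes "0 < x"
  shows "bessel_Q (n + k) x \<le> bessel_Q n x * bessel_F (real n + 1/2) x ^ k"
proof (induction k)
  case (Suc k)
  have "bessel_Q (Suc (n + k)) x \<le> bessel_F (real (n + k) + 1/2) x * bessel_Q (n + k) x"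
    using assms by (rule bessel_Q_Suc_le)
  \<comment> \<open>F decreases in the index, so the ratio bound at n dominates all later
    ones.\<close>
  also have "\<dots> \<le> bessel_F (real n + 1/2) x * (bessel_Q n x * bessel_F (real n + 1/2) x ^ k)"
    using assms Suc.IH
    by (intro mult_mono bessel_F_antimono less_imp_le[OF bessel_F_pos] less_imp_le[OF bessel_Q_pos]) auto
  finally show ?case by (simp add: mult_ac)
qed simp

lemma summable_bessel_Q:
  assumes "0 < x"
  shows "summable (\<lambda>k. bessel_Q (n + k) x)"
proof (rule summable_comparison_test')
  show "summable (\<lambda>k. bessel_Q n x * bessel_F (real n + 1/2) x ^ k)"
    using assms bessel_F_pos[OF assms, of "real n + 1/2"] bessel_F_less_1[OF assms, of "real n + 1/2"]
    by (intro summable_mult summable_geometric) auto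
  show "norm (bessel_Q (n + k) x) \<le> bessel_Q n x * bessel_F (real n + 1/2) x ^ k" for k
    using bessel_Q_geometric[OF assms] bessel_Q_pos[OF assms, of "n + k"] by simp
qed

text \<open>From index n + 1 on a geometric series with ratio F(n + 3/2) dominates; one further step
  down to n supplies the numerator F(n + 1/2).\<close>

lemma bessel_Q_tail_le:
  assumes "0 < x"
  shows "(\<Sum>k. bessel_Q (Suc n + k) x)
    \<le> bessel_Q n x * (bessel_F (real n + 1/2) x / (1 - bessel_F (real n + 3/2) x))"
proof -
  let ?F = "bessel_F (real n + 3/2) x"
  have F: "0 < ?F" "?F < 1" using assms by (auto intro: bessel_F_pos bessel_F_less_1)
  have eq: "real (Suc n) + 1/2 = real n + 3/2" by simp
  have "(\<Sum>k. bessel_Q (Suc n + k) x) \<le> (\<Sum>k. bessel_Q (Suc n) x * ?F ^ k)"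
    using bessel_Q_geometric[OF assms, of "Suc n"] F summable_bessel_Q[OF assms, of "Suc n"] unfolding eq
    by (intro suminf_le summable_mult summable_geometric) auto
  also have "\<dots> = bessel_Q (Suc n) x / (1 - ?F)"
    using F by (subst suminf_mult) (auto simp: suminf_geometric summable_geometric)
  also have "\<dots> \<le> bessel_F (real n + 1/2) x * bessel_Q n x / (1 - ?F)"
    using F bessel_Q_Suc_le[OF assms] by (intro divide_right_mono) auto
  finally show ?thesis by (simp add: mult.commute)
qed

lemma bessel_H_0_eq:
  assumes "0 < x"
  shows "bessel_H 0 x = (\<Sum>k. bessel_Q (Suc k) x)"
  unfolding bessel_H_def bessel_Q_def by simp

lemma bessel_H_0_split:
  assumes "0 < x" "0 < m"
  shows "bessel_H 0 x = (\<Sum>k=1..<m. bessel_Q k x) + (\<Sum>k. bessel_Q (m + k) x)"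
proof -
  have "bessel_H 0 x = (\<Sum>k. bessel_Q (Suc (k + (m - 1))) x) + (\<Sum>k<m - 1. bessel_Q (Suc k) x)"
    unfolding bessel_H_0_eq[OF assms(1)]
    using summable_bessel_Q[OF assms(1), of 1] by (intro suminf_split_initial_segment) simp
  also have "(\<Sum>k<m - 1. bessel_Q (Suc k) x) = (\<Sum>k=1..<m. bessel_Q k x)"
    using assms(2) by (intro sum.reindex_bij_witness[of _ "\<lambda>k. k - 1" Suc]) auto
  finally show ?thesis using assms(2) by (simp add: add.commute)
qed

lemma bessel_H_0_pos:
  assumes "0 < x"
  shows "0 < bessel_H 0 x"
  unfolding bessel_H_0_eq[OF assms]
  using summable_bessel_Q[OF assms, of 1] bessel_Q_pos[OF assms] by (intro suminf_pos) auto

section \<open>Bounds on H(0, x)\<close>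

lemma integral_gaussian_le:
  fixes a R :: real
  assumes "0 < a" "0 \<le> R"
  shows "integral {0..R} (\<lambda>t. exp (- a * t\<^sup>2)) \<le> sqrt (pi / (4 * a))"
proof -
  let ?f = "\<lambda>t. if t \<in> {0..} then exp (- a * t\<^sup>2) else 0"
  \<comment> \<open>The half-line integral of exp (- t^2), equal to sqrt pi / 2, is rescaled by the
    factor sqrt a; the indicator is invariant because sqrt a > 0.\<close>
  have "has_bochner_integral lborel (\<lambda>t. indicator {0..} (0 + sqrt a * t) *\<^sub>R exp (- (0 + sqrt a * t)\<^sup>2))
      ((sqrt pi / 2) /\<^sub>R \<bar>sqrt a\<bar>)"
    using assms(1) gaussian_moment_0 by (subst lborel_has_bochner_integral_real_affine_iff[symmetric]) auto
  moreover have "indicator {0..} (0 + sqrt a * t) *\<^sub>R exp (- (0 + sqrt a * t)\<^sup>2) = ?f t" for t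
    using assms(1) by (simp add: power_mult_distrib indicator_def zero_le_mult_iff)
  moreover have "(sqrt pi / 2) /\<^sub>R \<bar>sqrt a\<bar> = sqrt (pi / (4 * a))"
    using assms(1) by (simp add: real_sqrt_divide real_sqrt_mult field_simps)
  ultimately have "has_bochner_integral lborel ?f (sqrt (pi / (4 * a)))" by simp
  then have "(?f has_integral sqrt (pi / (4 * a))) UNIV"
    using has_integral_integral_lborel[of ?f] by (simp add: has_bochner_integral_iff)
  then have I: "((\<lambda>t. exp (- a * t\<^sup>2)) has_integral sqrt (pi / (4 * a))) {0..}"
    by (simp only: has_integral_restrict_UNIV)
  have "integral {0..R} (\<lambda>t. exp (- a * t\<^sup>2)) \<le> integral {0..} (\<lambda>t. exp (- a * t\<^sup>2))"
    using I by (intro integral_subset_le integrable_continuous_real continuous_intros)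
      (auto simp: integrable_on_def)
  with I show ?thesis by (simp add: integral_unique)
qed

text \<open>The classical lower bound for the Gaussian tail integral, in rationalised form:
  \<open>(sqrt (z\<^sup>2 + c) - z) / 2 = (c / 2) / (z + sqrt (z\<^sup>2 + c))\<close>.\<close>

definition gauss_tail :: "real \<Rightarrow> real \<Rightarrow> real" where
  "gauss_tail a z = exp (- a * z\<^sup>2) * ((sqrt (z\<^sup>2 + 2 / a) - z) / 2)"

text \<open>With s = sqrt (z^2 + 2/a), the relation a (s - z) (s + z) = 2 turns the derivative
  divided by the Gaussian into -(2 z/(s + z) + (s - z)/(2 s)). The bracket is 1 minus (s - z)^2 / (2
  s (s + z)), hence at most 1.\<close>

lemma gauss_tail_deriv:
  assumes "0 < a"
  obtains D where "(gauss_tail a has_real_derivative D) (at z)" "- exp (- a * z\<^sup>2) \<le> D"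
proof -
  define s where "s = sqrt (z\<^sup>2 + 2 / a)"
  have s2: "s\<^sup>2 = z\<^sup>2 + 2 / a" unfolding s_def using assms by simp
  have pos: "0 < z\<^sup>2 + 2 / a" using assms by (intro add_nonneg_pos) auto
  have "\<bar>z\<bar> < s" unfolding s_def using assms by (intro real_less_rsqrt) auto
  then have s: "0 < s" "0 < s + z" "0 < s - z" by linarith+
  define D where "D = exp (- a * z\<^sup>2) * (- (2 * a * z)) * ((s - z) / 2)
    + exp (- a * z\<^sup>2) * ((z / s - 1) / 2)"
  have "(gauss_tail a has_real_derivative D) (at z)"
  proof -
    have S: "((\<lambda>z. sqrt (z\<^sup>2 + 2 / a)) has_real_derivative z / s) (at z)"
      unfolding s_def using pos by (auto intro!: derivative_eq_intros simp: field_simps)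
    have E: "((\<lambda>z. exp (- a * z\<^sup>2)) has_real_derivative exp (- a * z\<^sup>2) * (- (2 * a * z))) (at z)"
      by (auto intro!: derivative_eq_intros)
    show ?thesis
      unfolding gauss_tail_def[abs_def]
      by (rule DERIV_cong[OF DERIV_mult[OF E DERIV_cdivide[OF DERIV_diff[OF S DERIV_ident]]]])
        (simp add: D_def s_def mult.commute)
  qed
  moreover have "- exp (- a * z\<^sup>2) \<le> D"
  proof -
    have "a * ((s - z) * (s + z)) = 2"
      using s2 assms by (simp add: field_simps power2_eq_square)
    moreover have "2 * a * z * ((s - z) / 2) * (s + z) = z * (a * ((s - z) * (s + z)))" by simp
    ultimately have "2 * a * z * ((s - z) / 2) * (s + z) = 2 * z" by simp
    then have "2 * a * z * ((s - z) / 2) = 2 * z / (s + z)"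
      using s by (metis nonzero_eq_divide_eq less_irrefl)
    moreover have "2 * z / (s + z) + (s - z) / (2 * s) \<le> 1"
    proof -
      have "1 - (2 * z / (s + z) + (s - z) / (2 * s)) = (s - z)\<^sup>2 / (2 * s * (s + z))"
        using s by (simp add: divide_simps) (simp add: algebra_simps power2_eq_square)
      also have "0 \<le> \<dots>" using s by simp
      finally show ?thesis by simp
    qed
    moreover have "(z / s - 1) / 2 = - ((s - z) / (2 * s))" using s by (simp add: field_simps)
    ultimately have "- 1 \<le> - (2 * a * z) * ((s - z) / 2) + (z / s - 1) / 2"
      unfolding mult_minus_left by linarith
    then have "exp (- a * z\<^sup>2) * (- 1) \<le> exp (- a * z\<^sup>2) * (- (2 * a * z) * ((s - z) / 2) + (z / s - 1) / 2)"
      by (intro mult_left_mono) auto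
    then show ?thesis unfolding D_def by (simp add: algebra_simps)
  qed
  ultimately show ?thesis using that by blast
qed

lemma gauss_tail_diff_le_integral:
  assumes "0 < a" "u \<le> v"
  shows "gauss_tail a u - gauss_tail a v \<le> integral {u..v} (\<lambda>t. exp (- a * t\<^sup>2))"
proof -
  have "\<forall>z. \<exists>D. (gauss_tail a has_real_derivative D) (at z) \<and> - exp (- a * z\<^sup>2) \<le> D"
    using gauss_tail_deriv[OF assms(1)] by blast
  then obtain D where D: "\<And>z. (gauss_tail a has_real_derivative D z) (at z)"
      "\<And>z. - exp (- a * z\<^sup>2) \<le> D z"
    by metis
  have "(D has_integral (gauss_tail a v - gauss_tail a u)) {u..v}"
    using assms(2) D(1) by (intro fundamental_theorem_of_calculus)
      (auto simp: has_real_derivative_iff_has_vector_derivative[symmetric] intro: has_field_derivative_at_within)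
  from has_integral_neg[OF this] have "((\<lambda>z. - D z) has_integral (gauss_tail a u - gauss_tail a v)) {u..v}"
    by simp
  moreover have "((\<lambda>t. exp (- a * t\<^sup>2)) has_integral integral {u..v} (\<lambda>t. exp (- a * t\<^sup>2))) {u..v}"
    by (intro integrable_integral integrable_continuous_real continuous_intros)
  moreover have "- D z \<le> exp (- a * z\<^sup>2)" for z using D(2)[of z] by linarith
  ultimately show ?thesis by (rule has_integral_le)
qed

lemma gauss_tail_diff_le_exp:
  assumes "0 < a" "0 \<le> u"
  shows "gauss_tail a u - gauss_tail a (u + 1) \<le> exp (- a * u\<^sup>2)"
proof -
  have "gauss_tail a u - gauss_tail a (u + 1) \<le> integral {u..u + 1} (\<lambda>t. exp (- a * t\<^sup>2))"
    using assms by (intro gauss_tail_diff_le_integral) auto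
  also have "\<dots> \<le> integral {u..u + 1} (\<lambda>t. exp (- a * u\<^sup>2))"
    using assms by (intro integral_le integrable_continuous_real continuous_intros) (auto intro!: power_mono)
  finally show ?thesis by simp
qed

text \<open>This decay makes the boundary term vanish when the upper limit of integration tends to
  infinity.\<close>

lemma gauss_tail_le:
  assumes "0 < a" "0 < z"
  shows "gauss_tail a z \<le> 1 / (2 * a * z)"
proof -
  have "sqrt (z\<^sup>2 + 2 / a) \<le> z + 1 / (a * z)"
    using assms by (intro real_le_lsqrt) (auto simp: power2_eq_square field_simps)
  then have le: "(sqrt (z\<^sup>2 + 2 / a) - z) / 2 \<le> 1 / (2 * a * z)" using assms by (simp add: field_simps)
  have "z \<le> sqrt (z\<^sup>2 + 2 / a)" using assms by (intro real_le_rsqrt) auto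
  then have "gauss_tail a z \<le> 1 * ((sqrt (z\<^sup>2 + 2 / a) - z) / 2)"
    unfolding gauss_tail_def using assms by (intro mult_right_mono) auto
  with le show ?thesis by linarith
qed

text \<open>The sum of a decreasing function is at most its integral over [0, z]. Adding
  \<open>gauss_tail a z\<close>, a lower bound for the integral beyond z, stays within the complete
  half-line integral.\<close>

lemma gaussian_sum_le:
  assumes a: "0 < a" and z: "real n \<le> z"
  shows "(\<Sum>k=1..n. exp (- a * (real k)\<^sup>2)) \<le> sqrt (pi / (4 * a)) - gauss_tail a z"
proof -
  let ?f = "\<lambda>t. exp (- a * t\<^sup>2)"
  have int: "?f integrable_on {u..v}" for u v
    by (intro integrable_continuous_real continuous_intros)
  have sum_le: "(\<Sum>k=1..n. ?f (real k)) \<le> integral {0..real n} ?f" for n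
  proof (induction n)
    case (Suc n)
    have "integral {real n..real (Suc n)} (\<lambda>t. ?f (real (Suc n))) \<le> integral {real n..real (Suc n)} ?f"
      using a int by (intro integral_le) (auto intro!: power_mono)
    with Suc have "(\<Sum>k=1..Suc n. ?f (real k)) \<le> integral {0..real n} ?f + integral {real n..real (Suc n)} ?f"
      by simp
    also have "\<dots> = integral {0..real (Suc n)} ?f"
      using int by (intro Henstock_Kurzweil_Integration.integral_combine) auto
    finally show ?case .
  qed simp
  \<comment> \<open>A finite cut-off \<open>R\<close> leaves the error
    \<open>gauss_tail a R\<close>, removed afterwards by letting \<open>R\<close> tend to
    infinity.\<close>
  have bound: "(\<Sum>k=1..n. ?f (real k)) + gauss_tail a z \<le> sqrt (pi / (4 * a)) + gauss_tail a R"
    if R: "z \<le> R" for R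
  proof -
    have "(\<Sum>k=1..n. ?f (real k)) + gauss_tail a z - gauss_tail a R
        \<le> integral {0..real n} ?f + integral {z..R} ?f"
      using sum_le[of n] gauss_tail_diff_le_integral[OF a R] by linarith
    also have "\<dots> \<le> integral {0..z} ?f + integral {z..R} ?f"
      using z int by (intro add_right_mono integral_subset_le) auto
    also have "\<dots> = integral {0..R} ?f"
      using z R int by (intro Henstock_Kurzweil_Integration.integral_combine) auto
    also have "\<dots> \<le> sqrt (pi / (4 * a))" using a z R by (intro integral_gaussian_le) auto
    finally show ?thesis by simp
  qed
  have "(\<Sum>k=1..n. ?f (real k)) + gauss_tail a z \<le> sqrt (pi / (4 * a)) + 0"
  proof (rule tendsto_lowerbound)
    show "((\<lambda>R. sqrt (pi / (4 * a)) + 1 / (2 * a * R)) \<longlongrightarrow> sqrt (pi / (4 * a)) + 0) at_top"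
      using a by (intro tendsto_add tendsto_const) real_asymp
    show "\<forall>\<^sub>F R in at_top. (\<Sum>k=1..n. ?f (real k)) + gauss_tail a z \<le> sqrt (pi / (4 * a)) + 1 / (2 * a * R)"
      using eventually_ge_at_top[of z] eventually_gt_at_top[of 0]
    proof eventually_elim
      case (elim R)
      then show ?case using bound[of R] gauss_tail_le[OF a, of R] by linarith
    qed
  qed simp
  then show ?thesis by simp
qed

lemma gauss_tail_eq:
  assumes "0 < a" "0 \<le> z"
  shows "gauss_tail a z = 1 / a * (exp (- a * z\<^sup>2) / (z + sqrt (z\<^sup>2 + 2 / a)))"
proof -
  define s where "s = sqrt (z\<^sup>2 + 2 / a)"
  have s2: "s\<^sup>2 = z\<^sup>2 + 2 / a" unfolding s_def using assms by simp
  have "0 < s" unfolding s_def using assms by (intro real_sqrt_gt_zero add_nonneg_pos) auto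
  then have s: "0 < z + s" using assms by simp
  have "a * ((s - z) * (z + s)) = 2"
    using s2 assms by (simp add: field_simps power2_eq_square)
  then have "(s - z) / 2 * (a * (z + s)) = 1" by (simp add: mult_ac)
  moreover have "a * (z + s) \<noteq> 0" using s assms by simp
  ultimately have "(s - z) / 2 = 1 / (a * (z + s))" by (metis nonzero_eq_divide_eq)
  then show ?thesis unfolding gauss_tail_def s_def[symmetric] by simp
qed

section \<open>Upper bound for H(0, x)\<close>

lemma bessel_H_0_le_H0_upper:
  assumes x: "0 < x"
  shows "bessel_H 0 x \<le> H0_upper x"
proof (cases "\<lfloor>x\<rfloor> \<ge> 2")
  case False
  \<comment> \<open>With n = 0 the geometric tail bound covers the whole series, and
    \<open>bessel_Q 0 x\<close> is 1.\<close>
  then show ?thesis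
    using bessel_Q_tail_le[OF x, of 0] x
    by (simp add: H0_upper_def Let_def bessel_H_0_eq bessel_Q_0)
next
  case True
  define m where "m = nat \<lfloor>x\<rfloor>"
  define a where "a = alpha0 / (2 * x)"
  have a: "0 < a" unfolding a_def using x alpha0_pos by simp
  have m: "2 \<le> m" "real m \<le> x" "real_of_int \<lfloor>x\<rfloor> = real m"
    unfolding m_def using True by linarith+
  obtain n where n: "m = Suc n" "1 \<le> n" using m(1) by (cases m) auto
  have set_eq: "{1..<m} = {1..n}" unfolding n by auto
  \<comment> \<open>All indices below m = floor x are at most x, so the Gaussian bound applies to
    each. The Gaussian tail is then cut off at z = x rather than at the last index.\<close>
  have "(\<Sum>k=1..<m. bessel_Q k x) \<le> (\<Sum>k=1..n. exp (- a * (real k)\<^sup>2))"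
    unfolding set_eq a_def using m n x by (intro sum_mono bessel_Q_le_exp) auto
  also have "\<dots> \<le> sqrt (pi / (4 * a)) - gauss_tail a x"
    using m n a by (intro gaussian_sum_le) auto
  also have "\<dots> = 2 * x / alpha0 * (1 / sqrt (8 * x / (pi * alpha0))
      - exp (- (alpha0 * x / 2)) / (x + sqrt (x\<^sup>2 + 4 * x / alpha0)))"
  proof -
    have "sqrt (pi / (4 * a)) = 2 * x / alpha0 * (1 / sqrt (8 * x / (pi * alpha0)))"
    proof (rule real_sqrt_unique)
      show "(2 * x / alpha0 * (1 / sqrt (8 * x / (pi * alpha0))))\<^sup>2 = pi / (4 * a)"
        unfolding a_def using x alpha0_pos
        by (simp add: power_mult_distrib power_divide field_simps power2_eq_square)
    qed (use x alpha0_pos in auto)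
    moreover have "1 / a = 2 * x / alpha0" "2 / a = 4 * x / alpha0" "- a * x\<^sup>2 = - (alpha0 * x / 2)"
      unfolding a_def using x by (simp_all add: power2_eq_square)
    then have "gauss_tail a x = 2 * x / alpha0 *
        (exp (- (alpha0 * x / 2)) / (x + sqrt (x\<^sup>2 + 4 * x / alpha0)))"
      unfolding gauss_tail_eq[OF a less_imp_le[OF x]] by (simp only:)
    ultimately show ?thesis by (simp only: right_diff_distrib)
  qed
  finally have sum: "(\<Sum>k=1..<m. bessel_Q k x) \<le> \<dots>" .
  have F: "bessel_F (real n + 3/2) x < 1" using x by (intro bessel_F_less_1) auto
  \<comment> \<open>The tail starts one step after n = m - 1, whence the exponent with (m - 1)^2 and
    the half-integers m - 1/2 and m + 1/2.\<close>
  have "(\<Sum>k. bessel_Q (m + k) x)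
      \<le> bessel_Q n x * (bessel_F (real n + 1/2) x / (1 - bessel_F (real n + 3/2) x))"
    unfolding n(1) using x by (rule bessel_Q_tail_le)
  also have "\<dots> \<le> exp (- (alpha0 / (2 * x)) * (real n)\<^sup>2)
      * (bessel_F (real n + 1/2) x / (1 - bessel_F (real n + 3/2) x))"
    using m n x F bessel_F_pos[OF x, of "real n + 1/2"] by (intro mult_right_mono bessel_Q_le_exp) auto
  finally have tail: "(\<Sum>k. bessel_Q (m + k) x) \<le> \<dots>" .
  have e: "real m - 1 = real n" "real m - 1/2 = real n + 1/2" "real m + 1/2 = real n + 3/2"
    unfolding n by simp_all
  show ?thesis
    using sum tail bessel_H_0_split[OF x, of m] m(1) True
    unfolding H0_upper_def Let_def m(3) e by simp
qed

section \<open>Lower bound for H(0, x)\<close>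

definition gauss_factor :: "real \<Rightarrow> real \<Rightarrow> real" where
  "gauss_factor x z = (sqrt (z\<^sup>2 + 4 * x) - z) / 2"

lemma gauss_factor_pos:
  assumes "0 < x"
  shows "0 < gauss_factor x z"
proof -
  have "\<bar>z\<bar> < sqrt (z\<^sup>2 + 4 * x)" using assms by (intro real_less_rsqrt) auto
  then have "z < sqrt (z\<^sup>2 + 4 * x)" by linarith
  then show ?thesis unfolding gauss_factor_def by simp
qed

text \<open>Solving c^2 + z c = x for its positive root gives this expression, which is also the
  factor beside the exponential in \<open>gauss_tail\<close> at a = 1 / (2 x). Estimates of it thus
  reduce to polynomial checks.\<close>

lemma gauss_factor_quadratic:
  assumes "0 < x"
  shows "(gauss_factor x z)\<^sup>2 + z * gauss_factor x z = x"
proof -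
  have "(sqrt (z\<^sup>2 + 4 * x))\<^sup>2 = z\<^sup>2 + 4 * x" using assms by simp
  then show ?thesis unfolding gauss_factor_def by (simp add: power2_eq_square field_simps)
qed

lemma gauss_factor_le:
  assumes "0 < x" "0 \<le> z" "0 \<le> c" "x \<le> c\<^sup>2 + z * c"
  shows "gauss_factor x z \<le> c"
proof -
  have "z\<^sup>2 + 4 * x \<le> (2 * c + z)\<^sup>2" using assms(4) by (simp add: power2_eq_square algebra_simps)
  then have "sqrt (z\<^sup>2 + 4 * x) \<le> 2 * c + z" using assms by (intro real_le_lsqrt) auto
  then show ?thesis unfolding gauss_factor_def by simp
qed

lemma gauss_factor_eq:
  assumes "0 < x" "0 \<le> z"
  shows "gauss_factor x z = 2 * x / (z + sqrt (z\<^sup>2 + 4 * x))"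
proof -
  have "0 < z + sqrt (z\<^sup>2 + 4 * x)" using assms by (intro add_nonneg_pos real_sqrt_gt_zero) auto
  moreover have "(sqrt (z\<^sup>2 + 4 * x))\<^sup>2 = z\<^sup>2 + 4 * x" using assms by simp
  then have "gauss_factor x z * (z + sqrt (z\<^sup>2 + 4 * x)) = 2 * x"
    unfolding gauss_factor_def by (simp add: power2_eq_square field_simps)
  ultimately show ?thesis by (metis nonzero_eq_divide_eq less_irrefl)
qed

text \<open>Completing the square, k (k + 1) = (k + 1/2)^2 - 1/4, turns the summands into a constant
  multiple of a Gaussian at half-integers, to which the unit-step bound on \<open>gauss_tail\<close>
  applies.\<close>

lemma exp_telescope:
  fixes k :: nat
  assumes x: "0 < x"
  shows "exp (- (real k * (real k + 1) / (2 * x))) * gauss_factor x (real k + 1/2)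
      - exp (- (real (Suc k) * (real (Suc k) + 1) / (2 * x))) * gauss_factor x (real (Suc k) + 1/2)
    \<le> exp (- (real k * (real k + 1) / (2 * x)))"
proof -
  have e: "exp (- (real j * (real j + 1) / (2 * x)))
      = exp (1 / (8 * x)) * exp (- (1 / (2 * x)) * (real j + 1/2)\<^sup>2)" for j
    unfolding exp_add[symmetric] using x by (simp add: field_simps power2_eq_square)
  have t: "gauss_tail (1 / (2 * x)) z = exp (- (1 / (2 * x)) * z\<^sup>2) * gauss_factor x z" for z
    unfolding gauss_tail_def gauss_factor_def using x by simp
  have "gauss_tail (1 / (2 * x)) (real k + 1/2) - gauss_tail (1 / (2 * x)) (real k + 1/2 + 1)
      \<le> exp (- (1 / (2 * x)) * (real k + 1/2)\<^sup>2)"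
    using x by (intro gauss_tail_diff_le_exp) auto
  moreover have "real k + 1/2 + 1 = real (Suc k) + 1/2" by simp
  ultimately have "exp (1 / (8 * x)) *
      (gauss_tail (1 / (2 * x)) (real k + 1/2) - gauss_tail (1 / (2 * x)) (real (Suc k) + 1/2))
      \<le> exp (1 / (8 * x)) * exp (- (1 / (2 * x)) * (real k + 1/2)\<^sup>2)"
    by (intro mult_left_mono) simp_all
  then show ?thesis unfolding t e by (simp only: right_diff_distrib mult.assoc)
qed

lemma exp_sum_ge_telescope:
  fixes m :: nat
  assumes x: "0 < x" and "n \<le> m"
  shows "exp (- (real n * (real n + 1) / (2 * x))) * gauss_factor x (real n + 1/2)
      - exp (- (real m * (real m + 1) / (2 * x))) * gauss_factor x (real m + 1/2)
    \<le> (\<Sum>k=n..<m. exp (- (real k * (real k + 1) / (2 * x))))"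
  using assms(2)
proof (induction m rule: dec_induct)
  case (step m)
  then show ?case using exp_telescope[OF x, of m] by simp
qed simp

text \<open>This is the [1/1] Pade approximant. Cleared of its denominator, the claim follows since
  (2 + t) exp (- t) + t has the derivative 1 - (1 + t) exp (- t) >= 0.\<close>

lemma exp_minus_ge_rational:
  fixes u :: real
  assumes "0 \<le> u"
  shows "(2 - u) / (2 + u) \<le> exp (- u)"
proof -
  have "(2 + 0) * exp (- 0) + 0 \<le> (2 + u) * exp (- u) + u"
  proof (rule DERIV_nonneg_imp_nondecreasing[OF assms])
    fix t :: real assume "0 \<le> t" "t \<le> u"
    have "exp (- t) * (1 + t) \<le> exp (- t) * exp t"
      by (intro mult_left_mono exp_ge_add_one_self) auto
    also have "\<dots> = 1" by (simp flip: exp_add)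
    finally have "0 \<le> 1 - (1 + t) * exp (- t)" by (simp add: mult.commute)
    moreover have "((\<lambda>u. (2 + u) * exp (- u) + u) has_real_derivative 1 - (1 + t) * exp (- t)) (at t)"
      by (auto intro!: derivative_eq_intros simp: algebra_simps)
    ultimately show "\<exists>y. ((\<lambda>u. (2 + u) * exp (- u) + u) has_real_derivative y) (at t) \<and> 0 \<le> y"
      by blast
  qed
  then have "2 - u \<le> (2 + u) * exp (- u)" by simp
  then show ?thesis using assms by (simp add: divide_le_eq mult.commute)
qed

lemma exp_minus_ge_rational_power:
  fixes u :: real
  assumes "0 \<le> u" "u \<le> 2"
  shows "((2 - u) / (2 + u)) ^ n \<le> exp (- (real n * u))"
proof -
  have "((2 - u) / (2 + u)) ^ n \<le> exp (- u) ^ n"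
    using assms exp_minus_ge_rational[of u] by (intro power_mono) auto
  then show ?thesis by (simp add: exp_of_nat_mult[symmetric])
qed

text \<open>The second exponential term of the lower bound for \<open>H(0, x)\<close> is smaller than the
  Gaussian tail beyond \<open>\<lfloor>x\<rfloor> + 1/2\<close> that the telescoping argument would produce. The difference
  is at most \<open>exp (- m (m + 1) / (2 x))\<close>; for \<open>m \<ge> 7\<close> it is absorbed by the slack in the first
  telescoping step alone, for \<open>3 \<le> m \<le> 6\<close> already the first two or three summands exceed the
  first term, and for \<open>m = 2\<close> the additional summand \<open>exp (- 10 / x)\<close> is needed.\<close>

lemma exp_sum_ge_large:
  fixes m :: nat
  assumes m: "7 \<le> m" "real m \<le> x" "x < real m + 1"
  shows "exp (- (1 / x)) * gauss_factor x (3/2)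
    \<le> (\<Sum>k=1..<m. exp (- (real k * (real k + 1) / (2 * x))))"
proof -
  let ?f = "\<lambda>k. exp (- (real k * (real k + 1) / (2 * x)))"
  let ?g = "gauss_factor x (5/2)"
  have x: "0 < x" using m by linarith
  have f1: "?f 1 = exp (- (1 / x))" and f2: "?f 2 = exp (- (1 / x)) * exp (- (2 / x))"
    using x by (simp_all add: field_simps flip: exp_add)
  have g: "0 < ?g" "?g\<^sup>2 + 5/2 * ?g = x"
    using gauss_factor_pos[OF x] gauss_factor_quadratic[OF x, of "5/2"] by auto
  \<comment> \<open>At c = \<open>?g\<close> + 1/2 the quadratic for 3/2 evaluates to x + 1, so
    passing from 5/2 to 3/2 raises the root by at most 1/2.\<close>
  have "gauss_factor x (3/2) \<le> ?g + 1/2"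
  proof (rule gauss_factor_le[OF x])
    have "(?g + 1/2)\<^sup>2 + 3/2 * (?g + 1/2) = (?g\<^sup>2 + 5/2 * ?g) + 1"
      by (simp add: power2_eq_square algebra_simps)
    then show "x \<le> (?g + 1/2)\<^sup>2 + 3/2 * (?g + 1/2)" unfolding g(2) by simp
  qed (use g in auto)
  \<comment> \<open>With g = \<open>?g\<close>, the quadratic and (g - 1)^2 >= 0 give 9 g <= 2 (x +
    1). The slack 1 - 1/2 - 4/9 = 1/18 is left to absorb the boundary term at m.\<close>
  moreover have "?g * (1 - exp (- (2 / x))) \<le> 4/9"
  proof -
    have "(2 - 2 / x) / (2 + 2 / x) \<le> exp (- (2 / x))" using x by (intro exp_minus_ge_rational) auto
    moreover have "1 - (2 - 2 / x) / (2 + 2 / x) = 2 / (x + 1)"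
      using x by (simp add: divide_simps)
    ultimately have "?g * (1 - exp (- (2 / x))) \<le> ?g * (2 / (x + 1))"
      using g by (intro mult_left_mono) auto
    also have "\<dots> \<le> 4/9"
    proof -
      have "0 \<le> (?g - 1)\<^sup>2" by simp
      then have "9 * ?g \<le> 2 * (x + 1)" using g(2) by (simp add: power2_eq_square algebra_simps)
      then show ?thesis using x by (simp add: field_simps)
    qed
    finally show ?thesis .
  qed
  ultimately have "1/18 + gauss_factor x (3/2) \<le> 1 + exp (- (2 / x)) * ?g"
    by (simp add: algebra_simps)
  then have "exp (- (1 / x)) * (1/18 + gauss_factor x (3/2)) \<le> exp (- (1 / x)) * (1 + exp (- (2 / x)) * ?g)"
    by (intro mult_left_mono) auto
  then have first: "exp (- (1 / x)) * (1/18) + exp (- (1 / x)) * gauss_factor x (3/2) \<le> ?f 1 + ?f 2 * ?g"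
    unfolding f1 f2 by (simp add: algebra_simps)
  \<comment> \<open>The root at m + 1/2 is at most 1 because x < m + 1. From m >= 7 comes (m - 1) (m
    + 2) >= 6 x, so the exponent is at least 1/x + 3 in size, and exp 3 >= 18.\<close>
  have last: "?f m * gauss_factor x (real m + 1/2) \<le> exp (- (1 / x)) * (1/18)"
  proof -
    have "?f m * gauss_factor x (real m + 1/2) \<le> ?f m * 1"
      using m x by (intro mult_left_mono gauss_factor_le) auto
    also have "\<dots> \<le> exp (- (1 / x) + - 3)"
    proof -
      have "6 * x \<le> (real m - 1) * (real m + 2)" using m by (intro mult_mono) auto
      then have "2 + 6 * x \<le> real m * (real m + 1)" by (simp add: algebra_simps)
      then have "(2 + 6 * x) / (2 * x) \<le> real m * (real m + 1) / (2 * x)"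
        using x by (intro divide_right_mono) auto
      moreover have "(2 + 6 * x) / (2 * x) = 1 / x + 3" using x by (simp add: field_simps)
      ultimately show ?thesis by simp
    qed
    also have "\<dots> = exp (- (1 / x)) * exp (- 3)" by (rule exp_add)
    also have "\<dots> \<le> exp (- (1 / x)) * (1/18)"
    proof (intro mult_left_mono)
      have "(1 + 1/2 + (1/2)\<^sup>2 / 2 :: real) ^ 6 \<le> exp (1/2) ^ 6"
        by (intro power_mono exp_lower_Taylor_quadratic) auto
      also have "\<dots> = exp 3" by (simp flip: exp_of_nat_mult)
      finally have "18 \<le> exp (3 :: real)" by (simp add: power2_eq_square eval_nat_numeral)
      then show "exp (- 3 :: real) \<le> 1/18" by (simp add: exp_minus field_simps)
    qed auto
    finally show ?thesis .
  qed
  have "?f 2 * gauss_factor x (real 2 + 1/2) - ?f m * gauss_factor x (real m + 1/2)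
      \<le> (\<Sum>k=2..<m. ?f k)"
    using m by (intro exp_sum_ge_telescope[OF x]) auto
  moreover have "(\<Sum>k=1..<m. ?f k) = ?f 1 + (\<Sum>k=2..<m. ?f k)"
    using m by (subst sum.atLeast_Suc_lessThan) (auto simp: numeral_2_eq_2)
  ultimately show ?thesis using first last by simp
qed

lemma exp_sum_ge_medium:
  fixes m :: nat
  assumes m: "3 \<le> m" "m < 7" "real m \<le> x" "x < real m + 1"
  shows "exp (- (1 / x)) * gauss_factor x (3/2)
    \<le> (\<Sum>k=1..<m. exp (- (real k * (real k + 1) / (2 * x))))"
proof -
  let ?f = "\<lambda>k. exp (- (real k * (real k + 1) / (2 * x)))"
  have x: "0 < x" using m by linarith
  have f: "?f 1 = exp (- (1 / x))" "?f 2 = exp (- (1 / x)) * exp (- (2 / x))"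
    "?f 3 = exp (- (1 / x)) * exp (- (5 / x))"
    using x by (simp_all add: field_simps flip: exp_add)
  have e: "(2 - u) / (2 + u) \<le> exp (- (c / x))" if "c / x \<le> u" "0 \<le> u" for c u
    using exp_minus_ge_rational[OF that(2)] that(1) by (elim order_trans) simp
  show ?thesis
  \<comment> \<open>In each case the root is bounded by a rational c with c^2 + 3/2 c at least the
    right end of the range of x, and the exponentials are bounded at its left end.\<close>
  proof (cases "m = 3")
    case True
    have "gauss_factor x (3/2) \<le> 3/2"
      using m True x by (intro gauss_factor_le) (auto simp: power2_eq_square)
    moreover have "2 / x \<le> 2/3" using m True by (simp add: field_simps)
    from e[OF this] have "1/2 \<le> exp (- (2 / x))" by simp
    ultimately have "gauss_factor x (3/2) \<le> 1 + exp (- (2 / x))" by linarith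
    then have "exp (- (1 / x)) * gauss_factor x (3/2) \<le> exp (- (1 / x)) * (1 + exp (- (2 / x)))"
      by (intro mult_left_mono) auto
    also have "\<dots> = (\<Sum>k=1..<m. ?f k)"
    proof -
      have "{1..<m} = {1, 2}" using True by auto
      then show ?thesis using f by (simp add: algebra_simps)
    qed
    finally show ?thesis .
  next
    case False
    have "gauss_factor x (3/2) \<le> 1 + exp (- (2 / x)) + exp (- (5 / x))"
    proof (cases "m = 4")
      case True
      have "gauss_factor x (3/2) \<le> 17/10"
        using m True x by (intro gauss_factor_le) (auto simp: power2_eq_square)
      moreover have "2 / x \<le> 1/2" "5 / x \<le> 5/4" using m True by (simp_all add: field_simps)
      from e[OF this(1)] e[OF this(2)] have "3/5 \<le> exp (- (2 / x))" "3/13 \<le> exp (- (5 / x))" by simp_all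
      ultimately show ?thesis by linarith
    next
      case F: False
      have "x < 7" "5 \<le> x" using m False F by linarith+
      then have "gauss_factor x (3/2) \<le> 2"
        by (intro gauss_factor_le) (auto simp: power2_eq_square)
      moreover have "2 / x \<le> 2/5" "5 / x \<le> 1" using \<open>5 \<le> x\<close> by (simp_all add: field_simps)
      from e[OF this(1)] e[OF this(2)] have "2/3 \<le> exp (- (2 / x))" "1/3 \<le> exp (- (5 / x))" by simp_all
      ultimately show ?thesis by linarith
    qed
    then have "exp (- (1 / x)) * gauss_factor x (3/2)
        \<le> exp (- (1 / x)) * (1 + exp (- (2 / x)) + exp (- (5 / x)))"
      by (intro mult_left_mono) auto
    also have "\<dots> = (\<Sum>k\<in>{1, 2, 3}. ?f k)" using f by (simp add: algebra_simps)
    also have "\<dots> \<le> (\<Sum>k=1..<m. ?f k)" using m False by (intro sum_mono2) auto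
    finally show ?thesis .
  qed
qed

text \<open>This is the case m = 2 divided by exp (- 1/x), with the subtracted term moved to the
  right; exp (- 9/x) stems from the summand exp (- 10/x).\<close>

lemma gauss_factor_small:
  assumes x: "2 \<le> x" "x < 3"
  shows "gauss_factor x (3/2) \<le> 1 + exp (- (9 / x))
    + 2 * x * exp (- (5 / x)) / (7/2 + sqrt ((7/2)\<^sup>2 + 8 * x / pi))"
proof (cases "x \<le> 5/2")
  case True
  then have "gauss_factor x (3/2) \<le> 1" using x by (intro gauss_factor_le) (auto simp: power2_eq_square)
  moreover have "0 \<le> 2 * x * exp (- (5 / x)) / (7/2 + sqrt ((7/2)\<^sup>2 + 8 * x / pi))"
    using x by (intro divide_nonneg_nonneg add_nonneg_nonneg mult_nonneg_nonneg) auto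
  ultimately show ?thesis by (smt (verit) exp_gt_zero)
next
  case False
  \<comment> \<open>1 + d is the tangent at x = 5/2 to the root as a function of x: there the root
    is 1 and its slope 2/7.\<close>
  define d where "d = (2 * x - 5) / 7"
  have d: "0 \<le> d" "x = 5/2 + 7/2 * d" using False unfolding d_def by (simp_all add: field_simps)
  have "(1 + d)\<^sup>2 + 3/2 * (1 + d) = x + d\<^sup>2"
    unfolding d(2) by (simp add: power2_eq_square field_simps)
  then have "gauss_factor x (3/2) \<le> 1 + d"
    using d(1) x by (intro gauss_factor_le) auto
  moreover have "x * exp (- (5 / x)) / 4 \<le> 2 * x * exp (- (5 / x)) / (7/2 + sqrt ((7/2)\<^sup>2 + 8 * x / pi))"
  proof -
    \<comment> \<open>As x < 3 < pi, the radicand is at most 49/4 + 8 = (9/2)^2, so the denominator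
      is at most 8.\<close>
    have "8 * x / pi \<le> 8"
      using x pi_gt3 by (simp add: field_simps)
    then have "sqrt ((7/2)\<^sup>2 + 8 * x / pi) \<le> 9/2"
      using x by (intro real_le_lsqrt) (auto simp: power2_eq_square)
    moreover have "0 \<le> sqrt ((7/2)\<^sup>2 + 8 * x / pi)" using x by simp
    ultimately have "2 * x * exp (- (5 / x)) / 8 \<le> 2 * x * exp (- (5 / x)) / (7/2 + sqrt ((7/2)\<^sup>2 + 8 * x / pi))"
      using x by (intro divide_left_mono mult_pos_pos add_pos_nonneg) auto
    then show ?thesis by simp
  qed
  \<comment> \<open>The split at 11/4 bounds d by 1/14 and 1/7. Writing 2 = 4 * 1/2, 20/11 = 5 *
    4/11 and 36/11 = 9 * 4/11 makes powers of the rational bound sharp enough.\<close>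
  moreover have "d \<le> exp (- (9 / x)) + x * exp (- (5 / x)) / 4"
  proof (cases "x \<le> 11/4")
    case True
    have "(81/625 :: real) \<le> exp (- 2)"
      using exp_minus_ge_rational_power[of "1/2" 4] by (simp add: power4_eq_xxxx)
    also have "\<dots> \<le> exp (- (5 / x))" using False by (simp add: field_simps)
    finally have "5/2 * (81/625) \<le> x * exp (- (5 / x))"
      using False by (intro mult_mono) auto
    then have "(1/14 :: real) \<le> x * exp (- (5 / x)) / 4" by simp
    moreover have "d \<le> 1/14" using True unfolding d_def by simp
    moreover have "0 < exp (- (9 / x))" by simp
    ultimately show ?thesis by linarith
  next
    case F: False
    have "((9/13)^5 :: real) \<le> exp (- (20/11))"
      using exp_minus_ge_rational_power[of "4/11" 5] by simp
    also have "\<dots> \<le> exp (- (5 / x))" using F by (simp add: field_simps)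
    finally have "11/4 * (9/13)^5 \<le> x * exp (- (5 / x))"
      using F by (intro mult_mono) auto
    moreover have "((9/13)^9 :: real) \<le> exp (- (36/11))"
      using exp_minus_ge_rational_power[of "4/11" 9] by simp
    moreover have "exp (- (36/11)) \<le> exp (- (9 / x))" using F by (simp add: field_simps)
    moreover have "d \<le> 1/7" using x unfolding d_def by simp
    moreover have "(1/7 :: real) \<le> (9/13)^9 + 11/4 * (9/13)^5 / 4" by (simp add: eval_nat_numeral)
    ultimately show ?thesis by linarith
  qed
  ultimately show ?thesis by linarith
qed

text \<open>The extra summand has index m + 2 because m and m + 1 are reserved for the F terms of
  the lower bound. For m >= 3 the sum alone exceeds \<open>?A\<close>, and \<open>?B\<close> and
  \<open>?T\<close> enter through their signs; for m = 2 their values are used.\<close>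

lemma H0_lower_exp_sum:
  fixes m :: nat
  assumes m: "2 \<le> m" "real m \<le> x" "x < real m + 1"
  shows "2 * x * exp (- (1 / x)) / (3/2 + sqrt (9/4 + 4 * x))
       - 2 * x * exp (- (1 / (2 * x)) * (real m + 1) * (real m + 2))
           / (real m + 3/2 + sqrt ((real m + 3/2)\<^sup>2 + 8 * x / pi))
    \<le> (\<Sum>k=1..<m. exp (- (real k * (real k + 1) / (2 * x))))
      + exp (- (real (m + 2) * (real (m + 2) + 1) / (2 * x)))"
    (is "?A - ?B \<le> ?S + ?T")
proof -
  have x: "0 < x" using m by linarith
  have A: "?A = exp (- (1 / x)) * gauss_factor x (3/2)"
    using x by (simp add: gauss_factor_eq power2_eq_square)
  have B: "0 \<le> ?B" using x by (intro divide_nonneg_nonneg add_nonneg_nonneg mult_nonneg_nonneg) auto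
  have T: "0 \<le> ?T" by simp
  consider "m = 2" | "3 \<le> m" "m < 7" | "7 \<le> m" using m(1) by linarith
  then show ?thesis
  proof cases
    case 1
    let ?R = "7/2 + sqrt ((7/2)\<^sup>2 + 8 * x / pi)"
    have "exp (- (1 / x)) * gauss_factor x (3/2)
      \<le> exp (- (1 / x)) * (1 + exp (- (9 / x)) + 2 * x * exp (- (5 / x)) / ?R)"
      using m 1 by (intro mult_left_mono gauss_factor_small) auto
    also have "\<dots> = exp (- (1 / x)) + exp (- (1 / x)) * exp (- (9 / x))
        + 2 * x * (exp (- (1 / x)) * exp (- (5 / x))) / ?R"
      by (simp add: algebra_simps)
    finally have le: "exp (- (1 / x)) * gauss_factor x (3/2) \<le> \<dots>" .
    have "{1..<m} = {1}" using 1 by auto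
    then have S: "?S = exp (- (1 / x))" using x by (simp add: field_simps)
    have T: "?T = exp (- (1 / x)) * exp (- (9 / x))"
      unfolding 1 exp_add[symmetric] using x by (simp add: field_simps)
    have e: "exp (- (1 / (2 * x)) * (real m + 1) * (real m + 2)) = exp (- (1 / x)) * exp (- (5 / x))"
      unfolding 1 exp_add[symmetric] using x by (simp add: field_simps)
    have R: "real m + 3/2 = 7/2" unfolding 1 by simp
    show ?thesis unfolding A S T e R using le by linarith
  next
    case 2
    then show ?thesis using exp_sum_ge_medium[of m x] m A B T by linarith
  next
    case 3
    then show ?thesis using exp_sum_ge_large[of m x] m A B T by linarith
  qed
qed

text \<open>All terms are positive, so H(0, x) may be truncated after index m + 2, or after index 2
  when x < 2.\<close>

lemma H0_lower_le_bessel_H_0: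
  assumes x: "0 < x"
  shows "H0_lower x \<le> bessel_H 0 x"
proof (cases "\<lfloor>x\<rfloor> \<ge> 2")
  case False
  have "bessel_F 1 x * (1 + bessel_F 2 x) \<le> bessel_Q 1 x + bessel_Q 2 x"
  proof -
    have 1: "bessel_F 1 x \<le> bessel_Q 1 x" using bessel_Q_Suc_ge[OF x, of 0] x by (simp add: bessel_Q_0)
    then have "bessel_F 2 x * bessel_F 1 x \<le> bessel_F 2 x * bessel_Q 1 x"
      using bessel_F_pos[OF x, of 2] by simp
    also have "\<dots> \<le> bessel_Q 2 x" using bessel_Q_Suc_ge[OF x, of 1] by (simp add: numeral_2_eq_2)
    finally show ?thesis using 1 by (simp add: algebra_simps)
  qed
  also have "\<dots> = (\<Sum>k=1..<3. bessel_Q k x)"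
  proof -
    have "{1..<3::nat} = {1, 2}" by auto
    then show ?thesis by simp
  qed
  also have "\<dots> \<le> bessel_H 0 x"
    using bessel_H_0_split[OF x, of 3] summable_bessel_Q[OF x, of 3] bessel_Q_pos[OF x]
    by (simp add: suminf_nonneg less_imp_le)
  finally show ?thesis using False by (simp add: H0_lower_def Let_def)
next
  case True
  define m where "m = nat \<lfloor>x\<rfloor>"
  have m: "2 \<le> m" "real m \<le> x" "x < real m + 1" "real_of_int \<lfloor>x\<rfloor> = real m"
    unfolding m_def using True by linarith+
  obtain n where n: "m = Suc n" using m(1) by (cases m) auto
  let ?f = "\<lambda>k. exp (- (real k * (real k + 1) / (2 * x)))"
  \<comment> \<open>The exponential bound at m - 1 is followed by one step with F(m), which is at
    least as good as the exponential bound at m.\<close>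
  let ?C = "exp (- ((real m - 1) * real m / (2 * x))) * bessel_F (real m) x"
  have Q1: "?C \<le> bessel_Q m x"
  proof -
    have "?C = bessel_F (real n + 1) x * ?f n" unfolding n by (simp add: mult.commute add.commute)
    also have "\<dots> \<le> bessel_F (real n + 1) x * bessel_Q n x"
      using x by (intro mult_left_mono bessel_Q_ge_exp less_imp_le[OF bessel_F_pos])
    also have "\<dots> \<le> bessel_Q m x" unfolding n using x by (rule bessel_Q_Suc_ge)
    finally show ?thesis .
  qed
  have Q2: "bessel_F (real m + 1) x * ?C \<le> bessel_Q (Suc m) x"
    using mult_left_mono[OF Q1, of "bessel_F (real m + 1) x"] bessel_F_pos[OF x, of "real m + 1"]
      bessel_Q_Suc_ge[OF x, of m] by linarith
  have "H0_lower x \<le> (\<Sum>k=1..<m. ?f k) + ?f (m + 2) + (?C + bessel_F (real m + 1) x * ?C)"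
    using H0_lower_exp_sum[OF m(1-3)] True unfolding H0_lower_def Let_def m(4)
    by (simp add: algebra_simps)
  also have "\<dots> \<le> (\<Sum>k=1..<m. bessel_Q k x) + bessel_Q (m + 2) x + (bessel_Q m x + bessel_Q (Suc m) x)"
    using Q1 Q2 by (intro add_mono sum_mono bessel_Q_ge_exp[OF x])
  also have "\<dots> = (\<Sum>k=1..<m + 3. bessel_Q k x)"
    using m(1) by (simp add: eval_nat_numeral)
  also have "\<dots> \<le> bessel_H 0 x"
    using bessel_H_0_split[OF x, of "m + 3"] summable_bessel_Q[OF x, of "m + 3"] bessel_Q_pos[OF x]
    by (simp add: suminf_nonneg less_imp_le)
  finally show ?thesis .
qed

text \<open>Positivity permits dividing by 1 + 2 \<open>H0_lower x\<close>. The subtracted fraction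
  has a numerator at most half of the first one, while the first denominator is at most twice the
  second.\<close>

lemma H0_lower_pos:
  assumes x: "0 < x"
  shows "0 < H0_lower x"
proof (cases "\<lfloor>x\<rfloor> \<ge> 2")
  case False
  have "0 < bessel_F 1 x * (1 + bessel_F 2 x)"
    using bessel_F_pos[OF x, of 1] bessel_F_pos[OF x, of 2] by (intro mult_pos_pos add_pos_pos) auto
  then show ?thesis using False by (simp add: H0_lower_def Let_def)
next
  case True
  define m where "m = real_of_int \<lfloor>x\<rfloor>"
  have m: "2 \<le> m" "x < m + 1" "2 \<le> x" unfolding m_def using True by linarith+
  let ?e = "exp (- (1 / (2 * x)) * (m + 1) * (m + 2))"
  let ?D = "m + 3/2 + sqrt ((m + 3/2)\<^sup>2 + 8 * x / pi)"
  have D: "0 < 3/2 + sqrt (9/4 + 4 * x)" using m by (intro add_pos_nonneg) auto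
  have "2 * x * ?e / ?D \<le> 2 * x * exp (- (1 / x)) / (3/2 + sqrt (9/4 + 4 * x))"
  proof -
    have "exp (- (1 / x)) / 2 \<ge> ?e"
    proof -
      have "?e = exp (- (1 / x)) * exp (- (m * (m + 3) / (2 * x)))"
        unfolding exp_add[symmetric] using m by (simp add: field_simps)
      also have "exp (- (m * (m + 3) / (2 * x))) \<le> exp (- 1)"
      proof -
        have "2 * x \<le> m * (m + 3)" using m by (intro mult_mono) auto
        then show ?thesis using m by (simp add: field_simps)
      qed
      also have "exp (- 1 :: real) \<le> 1/2"
        using exp_ge_add_one_self[of 1] by (simp add: exp_minus field_simps)
      finally show ?thesis by (simp add: mult_left_mono)
    qed
    moreover have "3/2 + sqrt (9/4 + 4 * x) \<le> 2 * ?D"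
    proof -
      have "sqrt (9/4 + 4 * x) \<le> sqrt ((2 * (m + 3/2))\<^sup>2)"
      proof (rule real_sqrt_le_mono)
        have "(2 * (m + 3/2))\<^sup>2 = 4 * m\<^sup>2 + 12 * m + 9" by (simp add: power2_eq_square algebra_simps)
        moreover have "0 \<le> m\<^sup>2" by simp
        ultimately show "9/4 + 4 * x \<le> (2 * (m + 3/2))\<^sup>2" using m by linarith
      qed
      then have "sqrt (9/4 + 4 * x) \<le> 2 * (m + 3/2)" using m by simp
      moreover have "m + 3/2 \<le> sqrt ((m + 3/2)\<^sup>2 + 8 * x / pi)"
        using m by (intro real_le_rsqrt) auto
      ultimately show ?thesis using m by (simp add: algebra_simps)
    qed
    ultimately have "?e / (2 * ?D) \<le> (exp (- (1 / x)) / 2) / (3/2 + sqrt (9/4 + 4 * x))"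
      using D by (intro frac_le) auto
    then have "4 * x * (?e / (2 * ?D)) \<le> 4 * x * ((exp (- (1 / x)) / 2) / (3/2 + sqrt (9/4 + 4 * x)))"
      using m by (intro mult_left_mono) auto
    moreover have "4 * x * (a / (2 * b)) = 2 * x * a / b" "4 * x * ((a / 2) / b) = 2 * x * a / b" for a b
      by simp_all
    ultimately show ?thesis by (simp only:)
  qed
  moreover have "0 < exp (- ((m - 1) * m / (2 * x))) * bessel_F m x * (1 + bessel_F (m + 1) x)"
    using bessel_F_pos[OF x, of m] bessel_F_pos[OF x, of "m + 1"]
    by (intro mult_pos_pos add_pos_pos) auto
  ultimately show ?thesis using True unfolding H0_lower_def Let_def m_def[symmetric] by simp
qed

section \<open>Symmetric Skellam distributions\<close>

text \<open>The fibre of the difference over z is a diagonal indexed by the smaller coordinate k;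
  the Poisson weights along it are exp (- 2 lam) times the terms of the Bessel series of order
  |z|.\<close>

lemma pmf_skellam:
  assumes "0 < lam"
  shows "pmf (skellam_pmf lam lam) z = exp (- (2 * lam)) * bessel_I (real (nat \<bar>z\<bar>)) (2 * lam)"
proof -
  let ?p = "poisson_pmf lam"
  define n where "n = nat \<bar>z\<bar>"
  define g :: "nat \<Rightarrow> nat \<times> nat" where "g k = (if 0 \<le> z then (k + n, k) else (k, k + n))" for k
  have vimage: "(\<lambda>(m, n). int m - int n) -` {z} = (\<Union>k. {g k})"
  proof (intro equalityI subsetI)
    fix p assume "p \<in> (\<lambda>(m, n). int m - int n) -` {z}"
    then have "p = g (if 0 \<le> z then snd p else fst p)"
      by (cases p) (auto simp: g_def n_def)
    then show "p \<in> (\<Union>k. {g k})" by blast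
  qed (auto simp: g_def n_def split: if_splits)
  have "disjoint_family (\<lambda>k. {g k})" by (auto simp: disjoint_family_on_def g_def)
  then have "(\<lambda>k. measure (pair_pmf ?p ?p) {g k}) sums measure (pair_pmf ?p ?p) (\<Union>k. {g k})"
    by (intro measure_pmf.finite_measure_UNION) auto
  moreover have "measure (pair_pmf ?p ?p) {g k}
      = exp (- (2 * lam)) * ((2 * lam / 2) ^ (2 * k + n) / (fact k * fact (k + n)))" for k
  proof -
    have p: "lam ^ (2 * k + n) = lam ^ k * (lam ^ k * lam ^ n)"
      unfolding mult_2 power_add by (simp only: mult.assoc)
    have "measure (pair_pmf ?p ?p) {g k} = pmf ?p (k + n) * pmf ?p k"
      by (simp add: measure_pmf_single g_def pmf_pair)
    also have "\<dots> = exp (- lam) * exp (- lam) * (lam ^ (2 * k + n) / (fact k * fact (k + n)))"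
      using assms unfolding p by (simp add: power_add mult_ac)
    finally show ?thesis by (simp flip: exp_add)
  qed
  ultimately have "(\<lambda>k. exp (- (2 * lam)) * ((2 * lam / 2) ^ (2 * k + n) / (fact k * fact (k + n))))
      sums measure (pair_pmf ?p ?p) (\<Union>k. {g k})" by simp
  moreover have "(\<lambda>k. exp (- (2 * lam)) * ((2 * lam / 2) ^ (2 * k + n) / (fact k * fact (k + n))))
      sums (exp (- (2 * lam)) * bessel_I (real n) (2 * lam))"
    using assms by (intro sums_mult bessel_I_nat_sums) auto
  ultimately have "measure (pair_pmf ?p ?p) (\<Union>k. {g k}) = exp (- (2 * lam)) * bessel_I (real n) (2 * lam)"
    by (rule sums_unique2)
  then show ?thesis unfolding skellam_pmf_def pmf_map vimage n_def .
qed

lemma skellam_tail_sums: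
  assumes "0 < lam"
  shows "(\<lambda>k. 2 * exp (- (2 * lam)) * bessel_I (real (n + Suc k)) (2 * lam))
    sums measure (skellam_pmf lam lam) {z. int n < \<bar>z\<bar>}"
proof -
  let ?p = "skellam_pmf lam lam"
  \<comment> \<open>The tail is grouped into pairs of equal mass; since n + Suc k > 0, each pair
    consists of two distinct points.\<close>
  let ?S = "\<lambda>k. {int (n + Suc k), - int (n + Suc k)}"
  have "disjoint_family ?S" by (auto simp: disjoint_family_on_def)
  then have "(\<lambda>k. measure ?p (?S k)) sums measure ?p (\<Union>k. ?S k)"
    by (intro measure_pmf.finite_measure_UNION) auto
  moreover have "(\<Union>k. ?S k) = {z. int n < \<bar>z\<bar>}"
  proof (intro equalityI subsetI)
    fix z :: int assume "z \<in> {z. int n < \<bar>z\<bar>}"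
    then have "z \<in> ?S (nat \<bar>z\<bar> - n - 1)" by auto
    then show "z \<in> (\<Union>k. ?S k)" by blast
  qed auto
  moreover have "measure ?p (?S k) = 2 * exp (- (2 * lam)) * bessel_I (real (n + Suc k)) (2 * lam)" for k
  proof -
    have "measure ?p (?S k) = (\<Sum>z\<in>?S k. pmf ?p z)" by (intro measure_measure_pmf_finite) auto
    also have "\<dots> = pmf ?p (int (n + Suc k)) + pmf ?p (- int (n + Suc k))"
      by (subst sum.insert) auto
    also have "\<dots> = 2 * exp (- (2 * lam)) * bessel_I (real (n + Suc k)) (2 * lam)"
      unfolding pmf_skellam[OF assms] abs_minus_cancel abs_of_nat nat_int by simp
    finally show ?thesis .
  qed
  ultimately show ?thesis by simp
qed

section \<open>Normalisation and the tail ratio\<close>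

lemma summable_bessel_I:
  assumes "0 < x"
  shows "summable (\<lambda>k. bessel_I (real (n + k)) x)"
proof -
  have "bessel_I (real (n + k)) x = bessel_I 0 x * bessel_Q (n + k) x" for k
    using bessel_I_pos[OF assms, of 0] by (simp add: bessel_Q_def)
  then show ?thesis using summable_mult[OF summable_bessel_Q[OF assms]] by simp
qed

lemma bessel_H_nat_eq:
  assumes "0 < x"
  shows "bessel_H (real n) x = (\<Sum>k. bessel_I (real (n + Suc k)) x) / bessel_I (real n) x"
  unfolding bessel_H_def of_nat_add[symmetric]
  using summable_bessel_I[OF assms, of "Suc n"] by (subst suminf_divide) auto

text \<open>The masses of 0 and of its complement add up to 1, and the latter is 2 exp (- 2 lam) I_0
  H(0, 2 lam).\<close>

lemma bessel_I_0_eq: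
  assumes "0 < lam"
  shows "exp (- (2 * lam)) * bessel_I 0 (2 * lam) * (1 + 2 * bessel_H 0 (2 * lam)) = 1"
proof -
  let ?p = "skellam_pmf lam lam" and ?x = "2 * lam"
  have x: "0 < ?x" using assms by simp
  have "measure ?p {z. int 0 < \<bar>z\<bar>} = 2 * exp (- ?x) * (\<Sum>k. bessel_I (real (0 + Suc k)) ?x)"
    using skellam_tail_sums[OF assms, of 0] summable_bessel_I[OF x, of 1]
    by (subst suminf_mult[symmetric]) (auto simp: sums_iff)
  moreover have HI: "bessel_H 0 ?x * bessel_I 0 ?x = (\<Sum>k. bessel_I (real (0 + Suc k)) ?x)"
    using bessel_H_nat_eq[OF x, of 0] bessel_I_pos[OF x, of 0] by simp
  moreover have "1 = pmf ?p 0 + measure ?p {z. int 0 < \<bar>z\<bar>}"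
  proof -
    have "measure ?p UNIV = measure ?p ({0} \<union> {z. int 0 < \<bar>z\<bar>})"
      by (rule arg_cong[where f = "measure ?p"]) auto
    also have "\<dots> = measure ?p {0} + measure ?p {z. int 0 < \<bar>z\<bar>}"
      by (intro measure_pmf.finite_measure_Union) auto
    finally show ?thesis by (simp add: measure_pmf_single)
  qed
  moreover have "pmf ?p 0 = exp (- ?x) * bessel_I 0 ?x"
    using pmf_skellam[OF assms, of 0] by simp
  moreover have "exp (- ?x) * bessel_I 0 ?x * (1 + 2 * bessel_H 0 ?x)
      = exp (- ?x) * bessel_I 0 ?x + 2 * exp (- ?x) * (bessel_H 0 ?x * bessel_I 0 ?x)"
    by (simp add: distrib_left)
  ultimately show ?thesis unfolding HI by linarith
qed

text \<open>The positive sum of the Bessel functions of order above n occurs both in the tail and in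
  H(n, 2 lam) and cancels. What remains is 2 exp (- 2 lam) I_n, rewritten by the normalisation of
  I_0.\<close>

lemma skellam_tail_ratio:
  assumes "0 < lam"
  shows "measure (skellam_pmf lam lam) {z. int n < \<bar>z\<bar>} / bessel_H (real n) (2 * lam)
    = 2 * bessel_Q n (2 * lam) / (1 + 2 * bessel_H 0 (2 * lam))"
proof -
  let ?x = "2 * lam"
  have x: "0 < ?x" using assms by simp
  let ?S = "\<Sum>k. bessel_I (real (n + Suc k)) ?x"
  have "0 < ?S"
    using summable_bessel_I[OF x, of "Suc n"] by (intro suminf_pos bessel_I_pos[OF x]) auto
  moreover have "measure (skellam_pmf lam lam) {z. int n < \<bar>z\<bar>} = 2 * exp (- ?x) * ?S"
    using skellam_tail_sums[OF assms, of n] summable_bessel_I[OF x, of "Suc n"]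
    by (subst suminf_mult[symmetric]) (auto simp: sums_iff)
  ultimately have "measure (skellam_pmf lam lam) {z. int n < \<bar>z\<bar>} / bessel_H (real n) ?x
      = 2 * (exp (- ?x) * bessel_I (real n) ?x)"
    using bessel_I_pos[OF x, of n] by (simp add: bessel_H_nat_eq[OF x])
  moreover have "exp (- ?x) * bessel_I (real n) ?x
      = (exp (- ?x) * bessel_I 0 ?x) * bessel_Q n ?x"
    using bessel_I_pos[OF x, of 0] by (simp add: bessel_Q_def)
  moreover have "exp (- ?x) * bessel_I 0 ?x = 1 / (1 + 2 * bessel_H 0 ?x)"
    using bessel_I_0_eq[OF assms] bessel_H_0_pos[OF x] by (simp add: eq_divide_eq)
  ultimately show ?thesis by simp
qed

section \<open>The four bounds on the tail ratio\<close>

theorem corollary2: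
  fixes M :: "'a measure" and W :: "'a \<Rightarrow> int" and lam :: real and \<nu> :: nat
  assumes "prob_space M"
    and "W \<in> M \<rightarrow>\<^sub>M count_space UNIV"
    and "distr M (count_space UNIV) W = measure_pmf (skellam_pmf lam lam)"
    and "lam > 0"
  shows
    "(real \<nu> \<le> 2 * lam \<longrightarrow>
        2 * exp (- (real \<nu> * (real \<nu> + 1) / (4 * lam))) / (1 + 2 * H0_upper (2 * lam))
          \<le> measure M {\<omega> \<in> space M. \<bar>W \<omega>\<bar> > int \<nu>} / bessel_H (real \<nu>) (2 * lam)
      \<and> measure M {\<omega> \<in> space M. \<bar>W \<omega>\<bar> > int \<nu>} / bessel_H (real \<nu>) (2 * lam)
          \<le> 2 * exp (- (alpha0 / (4 * lam)) * (real \<nu>)\<^sup>2) / (1 + 2 * H0_lower (2 * lam)))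
   \<and> (real \<nu> > 2 * lam \<longrightarrow>
        2 * exp (- (real_of_int \<lfloor>2 * lam\<rfloor> * (real_of_int \<lfloor>2 * lam\<rfloor> + 1) / (4 * lam)))
            * Beta (real_of_int \<lfloor>2 * lam\<rfloor> + lam + 1) (real \<nu> - real_of_int \<lfloor>2 * lam\<rfloor>)
            * (lam ^ nat (int \<nu> - \<lfloor>2 * lam\<rfloor>) / fact (nat (int \<nu> - \<lfloor>2 * lam\<rfloor> - 1)))
            / (1 + 2 * H0_upper (2 * lam))
          \<le> measure M {\<omega> \<in> space M. \<bar>W \<omega>\<bar> > int \<nu>} / bessel_H (real \<nu>) (2 * lam)
      \<and> measure M {\<omega> \<in> space M. \<bar>W \<omega>\<bar> > int \<nu>} / bessel_H (real \<nu>) (2 * lam)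
          \<le> 2 * exp (- (alpha0 / (4 * lam)) * (real_of_int \<lfloor>2 * lam\<rfloor>)\<^sup>2)
            * Beta (real_of_int \<lfloor>2 * lam\<rfloor> + 2 * lam + 1/2) (real \<nu> - real_of_int \<lfloor>2 * lam\<rfloor>)
            * ((2 * lam) ^ nat (int \<nu> - \<lfloor>2 * lam\<rfloor>) / fact (nat (int \<nu> - \<lfloor>2 * lam\<rfloor> - 1)))
            / (1 + 2 * H0_lower (2 * lam)))"
proof -
  define x where "x = 2 * lam"
  have x: "0 < x" and lam: "lam = x / 2" unfolding x_def using assms(4) by simp_all
  let ?D = "1 + 2 * bessel_H 0 x"
  have D: "0 < ?D" "?D \<le> 1 + 2 * H0_upper x" "0 < 1 + 2 * H0_lower x" "1 + 2 * H0_lower x \<le> ?D"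
    using bessel_H_0_pos[OF x] bessel_H_0_le_H0_upper[OF x] H0_lower_pos[OF x]
      H0_lower_le_bessel_H_0[OF x] by linarith+
  have "measure M {\<omega> \<in> space M. \<bar>W \<omega>\<bar> > int \<nu>}
      = measure (distr M (count_space UNIV) W) {z. int \<nu> < \<bar>z\<bar>}"
    using assms(2) by (subst measure_distr) (auto intro!: arg_cong[where f = "measure M"])
  then have ratio: "measure M {\<omega> \<in> space M. \<bar>W \<omega>\<bar> > int \<nu>} / bessel_H (real \<nu>) (2 * lam)
      = 2 * bessel_Q \<nu> x / ?D"
    unfolding assms(3) x_def using skellam_tail_ratio[OF assms(4)] by simp
  \<comment> \<open>All four claims reduce to bounds on \<open>bessel_Q \<nu> x\<close>: the upper
    bound on H(0, x) enlarges the denominator and serves the lower estimate, the lower bound serves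
    the upper one.\<close>
  have lower: "2 * L / (1 + 2 * H0_upper x) \<le> 2 * bessel_Q \<nu> x / ?D"
    if "L \<le> bessel_Q \<nu> x" for L
    using D that bessel_Q_pos[OF x, of \<nu>] by (intro frac_le) auto
  have upper: "2 * bessel_Q \<nu> x / ?D \<le> 2 * U / (1 + 2 * H0_lower x)"
    if "bessel_Q \<nu> x \<le> U" for U
    using D that bessel_Q_pos[OF x, of \<nu>] by (intro frac_le) auto
  show ?thesis
    unfolding ratio
  proof (intro conjI impI)
    assume le: "real \<nu> \<le> 2 * lam"
    have "exp (- (real \<nu> * (real \<nu> + 1) / (4 * lam))) \<le> bessel_Q \<nu> x"
      using bessel_Q_ge_exp[OF x, of \<nu>] unfolding lam by simp
    from lower[OF this] show "2 * exp (- (real \<nu> * (real \<nu> + 1) / (4 * lam))) / (1 + 2 * H0_upper (2 * lam))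
        \<le> 2 * bessel_Q \<nu> x / ?D"
      unfolding x_def .
    have "bessel_Q \<nu> x \<le> exp (- (alpha0 / (4 * lam)) * (real \<nu>)\<^sup>2)"
      using bessel_Q_le_exp[OF x, of \<nu>] le unfolding lam by simp
    from upper[OF this] show "2 * bessel_Q \<nu> x / ?D
        \<le> 2 * exp (- (alpha0 / (4 * lam)) * (real \<nu>)\<^sup>2) / (1 + 2 * H0_lower (2 * lam))"
      unfolding x_def .
  next
    assume "2 * lam < real \<nu>"
    \<comment> \<open>The product of ratios is split at m = floor (2 lam): the first m ratios give
      the Gaussian factor, the remaining d > 0 ratios the Beta factor.\<close>
    define m where "m = nat \<lfloor>2 * lam\<rfloor>"
    define d where "d = \<nu> - m"
    have floor: "\<lfloor>2 * lam\<rfloor> = int m" using assms(4) unfolding m_def by simp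
    have m: "real m \<le> x" "m < \<nu>" using \<open>2 * lam < real \<nu>\<close> assms(4) unfolding m_def x_def by linarith+
    then have d: "0 < d" "\<nu> = m + d" "nat (int \<nu> - int m) = d" "nat (int \<nu> - int m - 1) = d - 1"
      "real \<nu> - real m = real d"
      unfolding d_def by auto
    \<comment> \<open>The factorial of d - 1 in the statement cancels the one in the Beta value,
      leaving the rising factorial of the product bounds.\<close>
    have beta: "Beta a (real d) * (y ^ d / fact (d - 1)) = y ^ d / pochhammer a d" if "0 < a" for a y :: real
      using Beta_nat_right[OF that d(1)] by simp
    have "exp (- (real m * (real m + 1) / (4 * lam))) * (lam ^ d / pochhammer (real m + lam + 1) d)
        \<le> bessel_Q m x * (lam ^ d / pochhammer (real m + lam + 1) d)"
      using bessel_Q_ge_exp[OF x, of m] assms(4) unfolding x_def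
      by (intro mult_right_mono divide_nonneg_nonneg less_imp_le[OF pochhammer_pos]) auto
    also have "\<dots> \<le> bessel_Q \<nu> x"
      using bessel_Q_ge_pochhammer[OF x, of m d] unfolding d(2) x_def by simp
    finally have "exp (- (real m * (real m + 1) / (4 * lam)))
        * Beta (real m + lam + 1) (real d) * (lam ^ d / fact (d - 1)) \<le> bessel_Q \<nu> x"
      unfolding mult.assoc by (subst beta) (use assms(4) in auto)
    from lower[OF this]
    show "2 * exp (- (real_of_int \<lfloor>2 * lam\<rfloor> * (real_of_int \<lfloor>2 * lam\<rfloor> + 1) / (4 * lam)))
            * Beta (real_of_int \<lfloor>2 * lam\<rfloor> + lam + 1) (real \<nu> - real_of_int \<lfloor>2 * lam\<rfloor>)
            * (lam ^ nat (int \<nu> - \<lfloor>2 * lam\<rfloor>) / fact (nat (int \<nu> - \<lfloor>2 * lam\<rfloor> - 1)))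
            / (1 + 2 * H0_upper (2 * lam))
          \<le> 2 * bessel_Q \<nu> x / ?D"
      unfolding floor of_int_of_nat_eq d(3-5) x_def by (simp only: mult.assoc)
    have "bessel_Q \<nu> x \<le> bessel_Q m x * (x ^ d / pochhammer (real m + x + 1/2) d)"
      using bessel_Q_le_pochhammer[OF x, of m d] unfolding d(2) by simp
    also have "\<dots> \<le> exp (- (alpha0 / (4 * lam)) * (real m)\<^sup>2) * (x ^ d / pochhammer (real m + x + 1/2) d)"
      using bessel_Q_le_exp[OF x m(1)] x unfolding lam
      by (intro mult_right_mono divide_nonneg_nonneg less_imp_le[OF pochhammer_pos]) auto
    finally have "bessel_Q \<nu> x \<le> exp (- (alpha0 / (4 * lam)) * (real m)\<^sup>2)
        * Beta (real m + x + 1/2) (real d) * (x ^ d / fact (d - 1))"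
      unfolding mult.assoc by (subst beta) (use x in auto)
    from upper[OF this]
    show "2 * bessel_Q \<nu> x / ?D
          \<le> 2 * exp (- (alpha0 / (4 * lam)) * (real_of_int \<lfloor>2 * lam\<rfloor>)\<^sup>2)
            * Beta (real_of_int \<lfloor>2 * lam\<rfloor> + 2 * lam + 1/2) (real \<nu> - real_of_int \<lfloor>2 * lam\<rfloor>)
            * ((2 * lam) ^ nat (int \<nu> - \<lfloor>2 * lam\<rfloor>) / fact (nat (int \<nu> - \<lfloor>2 * lam\<rfloor> - 1)))
            / (1 + 2 * H0_lower (2 * lam))"
      unfolding floor of_int_of_nat_eq d(3-5) x_def by (simp only: mult.assoc)
  qed
qed

end
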